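(* Let $X$, $Y_k$ ($k\in\mathbb N$) and norms $\|\cdot\|_{X\oplus Y_k}$ be as in the generalized $\ell^2$-sum setting, and suppose the dual of $(X\oplus Y_k,\|\cdot\|_{X\oplus Y_k})$ is Fréchet smooth for every $k\in\mathbb N$. Then the dual norm of $\|\cdot\|_\Sigma$ is Fréchet differentiable at every $z^*\in\Lambda(X\oplus Y_k)\cap S_{(\Sigma(X\oplus Y_k))^*}$, $z^*=x^*+\sum_ky_k^*$ (with $x^*\in X^*$, $y_k^*\in Y_k^*$), for which $\|x^*\|_X<1$.
   Context: Setting: $(X,\|\cdot\|_X)$ and $(Y_k,\|\cdot\|_{Y_k})$, $k\in\mathbb N$, are Banach spaces; for each $k$, $\|\cdot\|_{X\oplus Y_k}$ is a norm on $X\oplus Y_k$ coinciding with $\|\cdot\|_X$ on $X$ and with $\|\cdot\|_{Y_k}$ on $Y_k$, and monotone: $\|x+y_k\|_{X\oplus Y_k}\ge\|x\|_X$. Duals of direct sums are identified with direct sums of duals via $(x^*+y^* )(x+y)=x^*(x)+y^*(y)$. $\Lambda(X\oplus Y_k)$ is the set of functionals $x^*+\sum_k\alpha_ky_k^*$ with $x^*\in X^*$, $y_k^*\in Y_k^*$, $\|x^*+y_k^*\|_{X\oplus Y_k}\le1$ for all $k$, $0\le\alpha_k\le1$, $\sum\alpha_k^2\le1$. $\Sigma(X\oplus Y_k)=\{x+y_1+y_2+\dots:x\in X,y_k\in Y_k,\sum\|y_k\|_{Y_k}^2<\infty\}$ with $\|z\|_\Sigma=\sup\{|z^*(z)|:z^*\in\Lambda(X\oplus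 Y_k)\}$. $S_{(\Sigma(X\oplus Y_k))^*}$ is the unit sphere of the dual of $(\Sigma(X\oplus Y_k),\|\cdot\|_\Sigma)$. A dual is Fréchet smooth if the dual norm is Fréchet differentiable at every nonzero point. *)

theory Defs
  imports "HOL-Analysis.Analysis"
begin

text \<open>Generic machinery: a linear subspace V of a space with addition pl and scalar
  multiplication sc, carrying a norm n.  Continuous linear functionals on V are
  represented as real-valued functions that are linear and bounded on V and vanish off V.\<close>

definition lin_fun_on :: "('v \<Rightarrow> 'v \<Rightarrow> 'v) \<Rightarrow> (real \<Rightarrow> 'v \<Rightarrow> 'v) \<Rightarrow> 'v set \<Rightarrow> ('v \<Rightarrow> real) \<Rightarrow> bool" where
  "lin_fun_on pl sc V f \<longleftrightarrow>
     (\<forall>u\<in>V. \<forall>v\<in>V. f (pl u v) = f u + f v) \<and> (\<forall>a. \<forall>v\<in>V. f (sc a v) = a * f v)"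

definition dual_sp :: "('v \<Rightarrow> 'v \<Rightarrow> 'v) \<Rightarrow> (real \<Rightarrow> 'v \<Rightarrow> 'v) \<Rightarrow> 'v set \<Rightarrow> ('v \<Rightarrow> real) \<Rightarrow> ('v \<Rightarrow> real) set" where
  "dual_sp pl sc V n = {f. (\<forall>v. v \<notin> V \<longrightarrow> f v = 0) \<and> lin_fun_on pl sc V f \<and>
                          (\<exists>C. \<forall>v\<in>V. \<bar>f v\<bar> \<le> C * n v)}"

text \<open>Dual norm of a functional.\<close>
definition dual_norm :: "'v set \<Rightarrow> ('v \<Rightarrow> real) \<Rightarrow> ('v \<Rightarrow> real) \<Rightarrow> real" where
  "dual_norm V n f = (SUP v\<in>{v\<in>V. n v \<le> 1}. \<bar>f v\<bar>)"

text \<open>Frechet differentiability of the dual norm (as a function on the dual space) at f: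
  there is a bounded linear functional L on the dual space with
  dual_norm (f + h) - dual_norm f - L h = o(dual_norm h).\<close>
definition frechet_diff_dual_norm ::
  "('v \<Rightarrow> 'v \<Rightarrow> 'v) \<Rightarrow> (real \<Rightarrow> 'v \<Rightarrow> 'v) \<Rightarrow> 'v set \<Rightarrow> ('v \<Rightarrow> real) \<Rightarrow> ('v \<Rightarrow> real) \<Rightarrow> bool" where
  "frechet_diff_dual_norm pl sc V n f \<longleftrightarrow>
    (\<exists>L :: ('v \<Rightarrow> real) \<Rightarrow> real.
       (\<forall>g\<in>dual_sp pl sc V n. \<forall>h\<in>dual_sp pl sc V n. L (\<lambda>v. g v + h v) = L g + L h) \<and>
       (\<forall>a. \<forall>g\<in>dual_sp pl sc V n. L (\<lambda>v. a * g v) = a * L g) \<and>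
       (\<exists>C. \<forall>g\<in>dual_sp pl sc V n. \<bar>L g\<bar> \<le> C * dual_norm V n g) \<and>
       (\<forall>\<epsilon>>0. \<exists>\<delta>>0. \<forall>h\<in>dual_sp pl sc V n. dual_norm V n h < \<delta> \<longrightarrow>
          \<bar>dual_norm V n (\<lambda>v. f v + h v) - dual_norm V n f - L h\<bar> \<le> \<epsilon> * dual_norm V n h))"

text \<open>The dual of (V, n) is Frechet smooth: the dual norm is Frechet differentiable
  at every nonzero functional.\<close>
definition dual_frechet_smooth ::
  "('v \<Rightarrow> 'v \<Rightarrow> 'v) \<Rightarrow> (real \<Rightarrow> 'v \<Rightarrow> 'v) \<Rightarrow> 'v set \<Rightarrow> ('v \<Rightarrow> real) \<Rightarrow> bool" where
  "dual_frechet_smooth pl sc V n \<longleftrightarrow>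
     (\<forall>f\<in>dual_sp pl sc V n. (\<exists>v\<in>V. f v \<noteq> 0) \<longrightarrow> frechet_diff_dual_norm pl sc V n f)"

text \<open>n is a norm on the subspace V of a real vector space.\<close>
definition is_norm_on :: "'v::real_vector set \<Rightarrow> ('v \<Rightarrow> real) \<Rightarrow> bool" where
  "is_norm_on V n \<longleftrightarrow> (\<forall>v\<in>V. 0 \<le> n v \<and> (n v = 0 \<longleftrightarrow> v = 0)) \<and>
     (\<forall>a. \<forall>v\<in>V. n (a *\<^sub>R v) = \<bar>a\<bar> * n v) \<and> (\<forall>u\<in>V. \<forall>v\<in>V. n (u + v) \<le> n u + n v)"

text \<open>(V, n) is complete.\<close>
definition complete_norm_on :: "'v::real_vector set \<Rightarrow> ('v \<Rightarrow> real) \<Rightarrow> bool" where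
  "complete_norm_on V n \<longleftrightarrow>
     (\<forall>s. (\<forall>i. s i \<in> V) \<and> (\<forall>e>0. \<exists>M. \<forall>i\<ge>M. \<forall>j\<ge>M. n (s i - s j) < e) \<longrightarrow>
          (\<exists>l\<in>V. (\<lambda>i. n (s i - l)) \<longlonglongrightarrow> 0))"

text \<open>Setting: X is the Banach space 'x; Y_k is the subspace Yset k of 'y; the norm on
  X \<oplus> Y_k is N k on UNIV \<times> Yset k; the norm of Y_k is y \<mapsto> N k (0, y).\<close>

definition Ynorm :: "(nat \<Rightarrow> 'x::real_vector \<times> 'y::real_vector \<Rightarrow> real) \<Rightarrow> nat \<Rightarrow> 'y \<Rightarrow> real" where
  "Ynorm N k y = N k (0, y)"

text \<open>Sigma(X \<oplus> Y_k): pairs (x, (y_k)_k) with y_k in Y_k and sum of squared norms finite.\<close>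
definition SigmaSet :: "(nat \<Rightarrow> 'y set) \<Rightarrow> (nat \<Rightarrow> 'x::real_vector \<times> 'y::real_vector \<Rightarrow> real)
     \<Rightarrow> ('x \<times> (nat \<Rightarrow> 'y)) set" where
  "SigmaSet Yset N = {(x, y). (\<forall>k. y k \<in> Yset k) \<and> summable (\<lambda>k. (Ynorm N k (y k))\<^sup>2)}"

definition sadd :: "'x::real_vector \<times> (nat \<Rightarrow> 'y::real_vector) \<Rightarrow> 'x \<times> (nat \<Rightarrow> 'y) \<Rightarrow> 'x \<times> (nat \<Rightarrow> 'y)" where
  "sadd z w = (fst z + fst w, \<lambda>k. snd z k + snd w k)"

definition sscale :: "real \<Rightarrow> 'x::real_vector \<times> (nat \<Rightarrow> 'y::real_vector) \<Rightarrow> 'x \<times> (nat \<Rightarrow> 'y)" where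
  "sscale a z = (a *\<^sub>R fst z, \<lambda>k. a *\<^sub>R snd z k)"

text \<open>Functional x* + y_k* on X \<oplus> Y_k.\<close>
definition pair_fun :: "'y set \<Rightarrow> ('x \<Rightarrow> real) \<Rightarrow> ('y \<Rightarrow> real) \<Rightarrow> 'x \<times> 'y \<Rightarrow> real" where
  "pair_fun Yk xs ys = (\<lambda>(x, y). if y \<in> Yk then xs x + ys y else 0)"

text \<open>Membership of x* + sum_k alpha_k y_k* in Lambda(X \<oplus> Y_k).\<close>
definition in_Lambda :: "(nat \<Rightarrow> 'y set) \<Rightarrow> (nat \<Rightarrow> 'x::real_normed_vector \<times> 'y::real_vector \<Rightarrow> real)
     \<Rightarrow> ('x \<Rightarrow> real) \<Rightarrow> (nat \<Rightarrow> real) \<Rightarrow> (nat \<Rightarrow> 'y \<Rightarrow> real) \<Rightarrow> bool" where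
  "in_Lambda Yset N xs \<alpha> ys \<longleftrightarrow>
     bounded_linear xs \<and>
     (\<forall>k. ys k \<in> dual_sp (+) (*\<^sub>R) (Yset k) (Ynorm N k)) \<and>
     (\<forall>k. dual_norm (UNIV \<times> Yset k) (N k) (pair_fun (Yset k) xs (ys k)) \<le> 1) \<and>
     (\<forall>k. 0 \<le> \<alpha> k \<and> \<alpha> k \<le> 1) \<and> summable (\<lambda>k. (\<alpha> k)\<^sup>2) \<and> (\<Sum>k. (\<alpha> k)\<^sup>2) \<le> 1"

text \<open>The functional on Sigma induced by x* + sum_k alpha_k y_k*.\<close>
definition lam_fun :: "(nat \<Rightarrow> 'y set) \<Rightarrow> (nat \<Rightarrow> 'x::real_normed_vector \<times> 'y::real_vector \<Rightarrow> real)
     \<Rightarrow> ('x \<Rightarrow> real) \<Rightarrow> (nat \<Rightarrow> real) \<Rightarrow> (nat \<Rightarrow> 'y \<Rightarrow> real) \<Rightarrow> 'x \<times> (nat \<Rightarrow> 'y) \<Rightarrow> real" where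
  "lam_fun Yset N xs \<alpha> ys = (\<lambda>(x, y). if (x, y) \<in> SigmaSet Yset N
       then xs x + (\<Sum>k. \<alpha> k * ys k (y k)) else 0)"

text \<open>The norm of Sigma(X \<oplus> Y_k).\<close>
definition sigma_norm :: "(nat \<Rightarrow> 'y set) \<Rightarrow> (nat \<Rightarrow> 'x::real_normed_vector \<times> 'y::real_vector \<Rightarrow> real)
     \<Rightarrow> 'x \<times> (nat \<Rightarrow> 'y) \<Rightarrow> real" where
  "sigma_norm Yset N z = Sup {\<bar>lam_fun Yset N xs \<alpha> ys z\<bar> | xs \<alpha> ys. in_Lambda Yset N xs \<alpha> ys}"

end

theory Submission
  imports Defs
begin

text \<open>By Smulyan's criterion the dual norm of Sigma is Frechet differentiable at
  z* = x* + \<Sum>\<alpha>_k y_k* as soon as z* strongly exposes the unit ball: points w, w' of the ball on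
  which z* is almost 1 are close. Since the norm of Sigma is a supremum over Lambda, it suffices
  that z* is uniformly smooth in every direction g* from Lambda: for small t there is a D with
  z*(w) \<plusminus> t g*(w) \<le> 1 \<plusminus> t D + t \<epsilon> on the unit ball. For this, z* \<plusminus> t g* is written as m times an
  element of Lambda with new weights \<gamma>_k, where m \<le> 1 \<plusminus> t D + o(t). Up to a tail of small
  l2-mass, only finitely many coordinates have \<parallel>x* + y_k*\<parallel> close to 1; on these the Frechet
  smoothness of the dual of X \<oplus> Y_k supplies D, and on all others \<parallel>x*\<parallel> < 1 leaves room for
  the perturbation.\<close>

section \<open>Elementary facts on real numbers and series\<close>

lemma summable_prod_abs:
  fixes p q :: "nat \<Rightarrow> real"
  assumes "summable (\<lambda>k. (p k)\<^sup>2)" "summable (\<lambda>k. (q k)\<^sup>2)"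
  shows "summable (\<lambda>k. \<bar>p k * q k\<bar>)"
    and "(\<Sum>k. \<bar>p k * q k\<bar>) \<le> ((\<Sum>k. (p k)\<^sup>2) + (\<Sum>k. (q k)\<^sup>2)) / 2"
proof -
  have le: "\<bar>p k * q k\<bar> \<le> ((p k)\<^sup>2 + (q k)\<^sup>2) / 2" for k
  proof -
    have "0 \<le> (\<bar>p k\<bar> - \<bar>q k\<bar>)\<^sup>2" by simp
    then show ?thesis by (simp add: power2_eq_square abs_mult algebra_simps)
  qed
  have s: "summable (\<lambda>k. ((p k)\<^sup>2 + (q k)\<^sup>2) / 2)"
    using assms by (intro summable_divide summable_add)
  show "summable (\<lambda>k. \<bar>p k * q k\<bar>)"
    by (rule summable_comparison_test[OF _ s]) (use le in auto)
  then have "(\<Sum>k. \<bar>p k * q k\<bar>) \<le> (\<Sum>k. ((p k)\<^sup>2 + (q k)\<^sup>2) / 2)"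
    by (intro suminf_le s le)
  also have "\<dots> = (\<Sum>k. (p k)\<^sup>2 + (q k)\<^sup>2) / 2"
    by (rule suminf_divide[OF summable_add[OF assms]])
  also have "\<dots> = ((\<Sum>k. (p k)\<^sup>2) + (\<Sum>k. (q k)\<^sup>2)) / 2"
    by (simp only: suminf_add[OF assms])
  finally show "(\<Sum>k. \<bar>p k * q k\<bar>) \<le> ((\<Sum>k. (p k)\<^sup>2) + (\<Sum>k. (q k)\<^sup>2)) / 2" .
qed

lemma finite_uniform_delta:
  assumes "finite A" "\<And>k. k \<in> A \<Longrightarrow> \<exists>\<delta>>0. Q k \<delta>"
    and mono: "\<And>k \<delta> \<delta>'. Q k \<delta> \<Longrightarrow> 0 < \<delta>' \<Longrightarrow> \<delta>' \<le> \<delta> \<Longrightarrow> Q k \<delta>'"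
  shows "\<exists>\<delta>>0. \<forall>k\<in>A. Q k (\<delta>::real)"
  using assms(1,2)
proof (induction A rule: finite_induct)
  case empty then show ?case by (intro exI[of _ 1]) auto
next
  case (insert x F)
  obtain \<delta>1 where d1: "\<delta>1 > 0" "\<forall>k\<in>F. Q k \<delta>1" using insert by auto
  obtain \<delta>2 where d2: "\<delta>2 > 0" "Q x \<delta>2" using insert by auto
  show ?case using d1 d2 mono by (intro exI[of _ "min \<delta>1 \<delta>2"]) auto
qed

lemma two_mult_le_weighted_squares: fixes x y \<mu> :: real assumes "\<mu> > 0" shows "2 * x * y \<le> x\<^sup>2 / \<mu> + \<mu> * y\<^sup>2"
proof -
  have "0 \<le> (x - \<mu> * y)\<^sup>2" by simp
  then have "2 * x * y * \<mu> \<le> x\<^sup>2 + \<mu>\<^sup>2 * y\<^sup>2" by (simp add: power2_eq_square algebra_simps)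
  then have "2 * x * y \<le> (x\<^sup>2 + \<mu>\<^sup>2 * y\<^sup>2) / \<mu>" using assms by (simp add: le_divide_eq)
  then show ?thesis using assms by (simp add: add_divide_distrib power2_eq_square)
qed

lemma suminf_tail_shift:
  fixes f :: "nat \<Rightarrow> real" assumes "summable f"
  shows "(\<Sum>k. if K < k then f k else 0) = (\<Sum>i. f (i + Suc K))"
proof -
  define g where "g k = (if K < k then f k else 0)" for k
  have "(\<lambda>i. g (i + Suc K)) = (\<lambda>i. f (i + Suc K))" unfolding g_def by auto
  moreover have "summable (\<lambda>i. f (i + Suc K))" by (rule iffD2[OF summable_iff_shift assms])
  ultimately have "(\<lambda>i. g (i + Suc K)) sums (\<Sum>i. f (i + Suc K))" by (simp add: summable_sums)
  then have "g sums ((\<Sum>i. f (i + Suc K)) + (\<Sum>i<Suc K. g i))" by (rule iffD1[OF sums_iff_shift])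
  moreover have "(\<Sum>i<Suc K. g i) = 0" unfolding g_def by (intro sum.neutral) auto
  ultimately have "g sums (\<Sum>i. f (i + Suc K))" by simp
  then show ?thesis unfolding g_def[abs_def] by (rule sums_unique[symmetric])
qed

lemma eventually_tail_sum_le:
  fixes f :: "nat \<Rightarrow> real" assumes f: "summable f" and e: "e > 0"
  obtains M where "\<And>K. K \<ge> M \<Longrightarrow> (\<Sum>k. if K < k then f k else 0) \<le> e"
proof -
  obtain M where M: "\<forall>n\<ge>M. norm (\<Sum>i. f (i + n)) < e" using suminf_exist_split[OF e f] by blast
  have "(\<Sum>k. if K < k then f k else 0) \<le> e" if "K \<ge> M" for K
  proof -
    have "norm (\<Sum>i. f (i + Suc K)) < e" using M that le_SucI by blast
    then show ?thesis using suminf_tail_shift[OF f, of K] by simp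
  qed
  then show ?thesis using that by blast
qed

lemma exists_pos_mult_less:
  fixes ps :: "(real \<times> real) list"
  assumes "\<forall>(c, b)\<in>set ps. 0 < b"
  obtains t :: real where "0 < t" "\<forall>(c, b)\<in>set ps. t * c < b"
proof -
  have "\<exists>t>0. \<forall>p\<in>set ps. 0 < snd p \<and> t * fst p < snd p"
  proof (rule finite_uniform_delta)
    fix p assume "p \<in> set ps"
    then have b: "0 < snd p" using assms by auto
    define t where "t = snd p / (\<bar>fst p\<bar> + 1)"
    have t: "0 < t" using b by (simp add: t_def add_pos_nonneg)
    have "t * fst p \<le> t * \<bar>fst p\<bar>" using t by (intro mult_left_mono) auto
    also have "\<dots> < t * (\<bar>fst p\<bar> + 1)" using t by simp
    also have "\<dots> = snd p" unfolding t_def by (simp add: add_pos_nonneg)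
    finally show "\<exists>t>0. 0 < snd p \<and> t * fst p < snd p" using t b by blast
  next
    fix p and t t' :: real assume "0 < snd p \<and> t * fst p < snd p" "0 < t'" "t' \<le> t"
    then show "0 < snd p \<and> t' * fst p < snd p"
    proof (cases "fst p \<ge> 0")
      case True
      then show ?thesis using \<open>t' \<le> t\<close> \<open>0 < snd p \<and> t * fst p < snd p\<close>
        by (meson le_less_trans mult_right_mono)
    next
      case False
      then have "t' * fst p < 0" using \<open>0 < t'\<close> by (simp add: mult_pos_neg)
      then show ?thesis using \<open>0 < snd p \<and> t * fst p < snd p\<close> by simp
    qed
  qed simp
  then show ?thesis using that by fastforce
qed

lemma exists_small_quadratic:
  fixes A B e :: real assumes "A \<ge> 0" "B \<ge> 0" "e > 0"
  obtains \<mu> where "0 < \<mu>" "\<mu> \<le> 1" "A * \<mu>\<^sup>2 + B * \<mu> \<le> e"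
proof -
  define \<mu> where "\<mu> = min 1 (e / (A + B + 1))"
  have \<mu>: "0 < \<mu>" "\<mu> \<le> 1" using assms by (auto simp: \<mu>_def)
  have "A * \<mu>\<^sup>2 \<le> A * \<mu>" using \<mu> assms by (intro mult_left_mono) (auto simp: power2_eq_square mult_left_le)
  then have "A * \<mu>\<^sup>2 + B * \<mu> \<le> (A + B) * \<mu>" by (simp add: algebra_simps)
  also have "\<dots> \<le> (A + B) * (e / (A + B + 1))" using assms by (intro mult_left_mono) (auto simp: \<mu>_def)
  also have "\<dots> \<le> e" using assms by (simp add: field_simps)
  finally show ?thesis using that \<mu> by blast
qed

lemma max_one_sqrt_bounds:
  fixes s x :: real assumes s: "0 \<le> s" "s \<le> 1 + x" and x: "0 \<le> x"
  shows "1 \<le> max 1 (sqrt s)" "s \<le> (max 1 (sqrt s))\<^sup>2" "max 1 (sqrt s) - 1 \<le> x / 2"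
proof -
  show "1 \<le> max 1 (sqrt s)" by simp
  have "s = (sqrt s)\<^sup>2" using s by simp
  also have "\<dots> \<le> (max 1 (sqrt s))\<^sup>2" using s by (intro power_mono) auto
  finally show "s \<le> (max 1 (sqrt s))\<^sup>2" .
  have "2 * sqrt s \<le> (sqrt s)\<^sup>2 + 1" using sum_squares_bound[of "sqrt s" 1] by (simp add: power2_eq_square)
  then show "max 1 (sqrt s) - 1 \<le> x / 2" using s x by (simp add: max_def)
qed

section \<open>Dual norms on a normed subset and Smulyan's criterion\<close>

locale normed_subset =
  fixes pl :: "'v \<Rightarrow> 'v \<Rightarrow> 'v" and sc :: "real \<Rightarrow> 'v \<Rightarrow> 'v" and V :: "'v set" and n :: "'v \<Rightarrow> real"
  assumes pl_in: "\<And>u v. u \<in> V \<Longrightarrow> v \<in> V \<Longrightarrow> pl u v \<in> V"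
    and sc_in: "\<And>c v. v \<in> V \<Longrightarrow> sc c v \<in> V"
    and n_sc: "\<And>c v. v \<in> V \<Longrightarrow> n (sc c v) = \<bar>c\<bar> * n v"
    and n_nonneg: "\<And>v. v \<in> V \<Longrightarrow> 0 \<le> n v"
    and V_nonempty: "V \<noteq> {}"
begin

definition bounded_functional :: "('v \<Rightarrow> real) \<Rightarrow> bool" where
  "bounded_functional f \<longleftrightarrow> (\<forall>c. \<forall>v\<in>V. f (sc c v) = c * f v) \<and> (\<exists>C. \<forall>v\<in>V. \<bar>f v\<bar> \<le> C * n v)"

lemma exists_norm_zero: "\<exists>z\<in>V. n z = 0"
proof -
  obtain v where "v \<in> V" using V_nonempty by auto
  then show ?thesis using sc_in n_sc by (intro bexI[of _ "sc 0 v"]) auto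
qed

lemma unit_ball_nonempty: "{v\<in>V. n v \<le> 1} \<noteq> {}"
  using exists_norm_zero by auto

lemma bdd_above_unit_ball:
  assumes "bounded_functional f" shows "bdd_above ((\<lambda>v. \<bar>f v\<bar>) ` {v\<in>V. n v \<le> 1})"
proof -
  obtain C where C: "\<forall>v\<in>V. \<bar>f v\<bar> \<le> C * n v" using assms unfolding bounded_functional_def by auto
  have "\<bar>f v\<bar> \<le> max C 0" if "v \<in> V" "n v \<le> 1" for v
  proof -
    have "\<bar>f v\<bar> \<le> C * n v" using C that by auto
    also have "\<dots> \<le> max C 0 * n v" using n_nonneg[OF that(1)] by (simp add: mult_right_mono)
    also have "\<dots> \<le> max C 0" using that n_nonneg[OF that(1)] by (simp add: mult_left_le)
    finally show ?thesis .
  qed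
  then show ?thesis by (intro bdd_aboveI[where M="max C 0"]) auto
qed

lemma dual_norm_upper:
  assumes "bounded_functional f" "v \<in> V" "n v \<le> 1" shows "\<bar>f v\<bar> \<le> dual_norm V n f"
  unfolding dual_norm_def using assms by (intro cSUP_upper bdd_above_unit_ball) auto

lemma dual_norm_nonneg: assumes "bounded_functional f" shows "0 \<le> dual_norm V n f"
  using exists_norm_zero dual_norm_upper[OF assms] by (smt (verit) abs_ge_zero)

lemma dual_norm_least:
  assumes "\<And>v. v \<in> V \<Longrightarrow> n v \<le> 1 \<Longrightarrow> \<bar>f v\<bar> \<le> M" shows "dual_norm V n f \<le> M"
  unfolding dual_norm_def using assms unit_ball_nonempty by (intro cSUP_least) auto

lemma dual_norm_bound:
  assumes "bounded_functional f" "v \<in> V" shows "\<bar>f v\<bar> \<le> dual_norm V n f * n v"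
proof (cases "n v = 0")
  case True
  obtain C where C: "\<forall>v\<in>V. \<bar>f v\<bar> \<le> C * n v" using assms unfolding bounded_functional_def by auto
  then show ?thesis using True assms by fastforce
next
  case False
  then have pos: "n v > 0" using n_nonneg[OF assms(2)] by auto
  let ?w = "sc (1 / n v) v"
  have w: "?w \<in> V" "n ?w = 1" using sc_in[OF assms(2)] n_sc[OF assms(2)] pos by auto
  have "f ?w = f v / n v" using assms unfolding bounded_functional_def by auto
  moreover have "\<bar>f ?w\<bar> \<le> dual_norm V n f" using dual_norm_upper[OF assms(1) w(1)] w by auto
  ultimately show ?thesis using pos by (simp add: abs_div divide_le_eq)
qed

lemma bounded_functional_add:
  assumes "bounded_functional f" "bounded_functional g" shows "bounded_functional (\<lambda>v. f v + g v)"
proof -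
  obtain C where C: "\<forall>v\<in>V. \<bar>f v\<bar> \<le> C * n v" using assms unfolding bounded_functional_def by auto
  obtain D where D: "\<forall>v\<in>V. \<bar>g v\<bar> \<le> D * n v" using assms unfolding bounded_functional_def by auto
  have "\<forall>v\<in>V. \<bar>f v + g v\<bar> \<le> (C + D) * n v"
    using C D by (auto simp: distrib_right intro: order_trans[OF abs_triangle_ineq add_mono])
  then show ?thesis using assms unfolding bounded_functional_def by (auto simp: distrib_left)
qed

lemma bounded_functional_scale:
  assumes "bounded_functional f" shows "bounded_functional (\<lambda>v. c * f v)"
proof -
  obtain C where C: "\<forall>v\<in>V. \<bar>f v\<bar> \<le> C * n v" using assms unfolding bounded_functional_def by auto
  have "\<forall>v\<in>V. \<bar>c * f v\<bar> \<le> (\<bar>c\<bar> * C) * n v"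
    using C by (auto simp: abs_mult mult.assoc intro: mult_left_mono)
  then show ?thesis using assms unfolding bounded_functional_def by auto
qed

lemma dual_norm_triangle:
  assumes "bounded_functional f" "bounded_functional g"
  shows "dual_norm V n (\<lambda>v. f v + g v) \<le> dual_norm V n f + dual_norm V n g"
proof (rule dual_norm_least)
  fix v assume v: "v \<in> V" "n v \<le> 1"
  have "\<bar>f v + g v\<bar> \<le> \<bar>f v\<bar> + \<bar>g v\<bar>" by (rule abs_triangle_ineq)
  also have "\<dots> \<le> dual_norm V n f + dual_norm V n g"
    using dual_norm_upper[OF assms(1) v] dual_norm_upper[OF assms(2) v] by simp
  finally show "\<bar>f v + g v\<bar> \<le> dual_norm V n f + dual_norm V n g" .
qed

lemma dual_norm_scale_le:
  assumes "bounded_functional f" shows "dual_norm V n (\<lambda>v. c * f v) \<le> \<bar>c\<bar> * dual_norm V n f"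
proof (rule dual_norm_least)
  fix v assume v: "v \<in> V" "n v \<le> 1"
  show "\<bar>c * f v\<bar> \<le> \<bar>c\<bar> * dual_norm V n f"
    using dual_norm_upper[OF assms v] by (simp add: abs_mult mult_left_mono)
qed

lemma dual_norm_scale:
  assumes "bounded_functional f" shows "dual_norm V n (\<lambda>v. c * f v) = \<bar>c\<bar> * dual_norm V n f"
proof (cases "c = 0")
  case True
  then show ?thesis
    using dual_norm_scale_le[OF assms, of 0] dual_norm_nonneg[OF bounded_functional_scale[OF assms, of 0]]
    by auto
next
  case False
  have "dual_norm V n f = dual_norm V n (\<lambda>v. (1/c) * (c * f v))" using False by simp
  also have "\<dots> \<le> \<bar>1/c\<bar> * dual_norm V n (\<lambda>v. c * f v)"
    by (rule dual_norm_scale_le[OF bounded_functional_scale[OF assms]])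
  finally have "\<bar>c\<bar> * dual_norm V n f \<le> dual_norm V n (\<lambda>v. c * f v)"
    using False by (simp add: abs_div field_simps)
  with dual_norm_scale_le[OF assms, of c] show ?thesis by linarith
qed

lemma dual_norm_lincomb:
  assumes "bounded_functional f" "bounded_functional g"
  shows "dual_norm V n (\<lambda>v. c * f v + d * g v) \<le> \<bar>c\<bar> * dual_norm V n f + \<bar>d\<bar> * dual_norm V n g"
  using dual_norm_triangle[OF bounded_functional_scale[OF assms(1)] bounded_functional_scale[OF assms(2)]]
    dual_norm_scale[OF assms(1)] dual_norm_scale[OF assms(2)]
  by simp

lemma dual_norm_approx:
  assumes "bounded_functional f" "e > 0"
  shows "\<exists>v\<in>V. n v \<le> 1 \<and> dual_norm V n f - e < f v"
proof -
  have "dual_norm V n f - e < dual_norm V n f" using assms by simp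
  then obtain v where v: "v \<in> V" "n v \<le> 1" "dual_norm V n f - e < \<bar>f v\<bar>"
    unfolding dual_norm_def using less_cSUP_iff[OF unit_ball_nonempty bdd_above_unit_ball[OF assms(1)]]
    by auto
  show ?thesis
  proof (cases "f v \<ge> 0")
    case True
    then show ?thesis using v by auto
  next
    case False
    have "f (sc (-1) v) = - f v" using assms v unfolding bounded_functional_def by auto
    then show ?thesis using v False sc_in[OF v(1)] n_sc[OF v(1), of "-1"]
      by (intro bexI[of _ "sc (-1) v"]) auto
  qed
qed

lemma dual_sp_bounded_functional:
  "h \<in> dual_sp pl sc V n \<Longrightarrow> bounded_functional h"
  unfolding dual_sp_def lin_fun_on_def bounded_functional_def by auto

lemma dual_sp_diff:
  assumes "h \<in> dual_sp pl sc V n" "w \<in> V" "w' \<in> V"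
  shows "h (pl w (sc (-1) w')) = h w - h w'"
  using assms sc_in unfolding dual_sp_def lin_fun_on_def by auto

lemma dual_sp_add:
  assumes "g \<in> dual_sp pl sc V n" "h \<in> dual_sp pl sc V n"
  shows "(\<lambda>v. g v + h v) \<in> dual_sp pl sc V n"
proof -
  obtain C where C: "\<forall>v\<in>V. \<bar>g v\<bar> \<le> C * n v" using assms unfolding dual_sp_def by auto
  obtain D where D: "\<forall>v\<in>V. \<bar>h v\<bar> \<le> D * n v" using assms unfolding dual_sp_def by auto
  have "\<forall>v\<in>V. \<bar>g v + h v\<bar> \<le> (C + D) * n v"
    using C D by (auto simp: distrib_right intro: order_trans[OF abs_triangle_ineq add_mono])
  then show ?thesis using assms unfolding dual_sp_def lin_fun_on_def by (auto simp: distrib_left)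
qed

lemma dual_sp_scale:
  assumes "g \<in> dual_sp pl sc V n" shows "(\<lambda>v. a * g v) \<in> dual_sp pl sc V n"
proof -
  obtain C where C: "\<forall>v\<in>V. \<bar>g v\<bar> \<le> C * n v" using assms unfolding dual_sp_def by auto
  have "\<forall>v\<in>V. \<bar>a * g v\<bar> \<le> (\<bar>a\<bar> * C) * n v"
    using C by (auto simp: abs_mult mult.assoc intro: mult_left_mono)
  then have "\<exists>C. \<forall>v\<in>V. \<bar>a * g v\<bar> \<le> C * n v" by blast
  then show ?thesis using assms unfolding dual_sp_def lin_fun_on_def by (simp add: algebra_simps)
qed

lemma dual_sp_lipschitz:
  assumes "h \<in> dual_sp pl sc V n" "w \<in> V" "w' \<in> V"
  shows "\<bar>h w - h w'\<bar> \<le> dual_norm V n h * n (pl w (sc (-1) w'))"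
  using dual_norm_bound[OF dual_sp_bounded_functional[OF assms(1)] pl_in[OF assms(2) sc_in[OF assms(3)]],
      of "-1"] dual_sp_diff[OF assms] by simp

definition strongly_exposing :: "('v \<Rightarrow> real) \<Rightarrow> bool" where
  "strongly_exposing f \<longleftrightarrow> (\<forall>\<epsilon>>0. \<exists>\<delta>>0. \<forall>w\<in>V. \<forall>w'\<in>V. n w \<le> 1 \<longrightarrow> n w' \<le> 1 \<longrightarrow>
      1 - \<delta> \<le> f w \<longrightarrow> 1 - \<delta> \<le> f w' \<longrightarrow> n (pl w (sc (-1) w')) \<le> \<epsilon>)"

lemma norming_sequence:
  assumes "bounded_functional f" "dual_norm V n f = 1"
  obtains zs where "\<And>i. zs i \<in> V" "\<And>i. n (zs i) \<le> 1" "\<And>i. 1 - 1 / Suc i < f (zs i)"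
proof -
  have "\<exists>z\<in>V. n z \<le> 1 \<and> 1 - 1 / Suc i < f z" for i
    using dual_norm_approx[OF assms(1), of "1 / Suc i"] assms(2) by auto
  then show ?thesis using that by metis
qed

lemma norming_sequence_tendsto:
  assumes "bounded_functional f" "dual_norm V n f = 1"
    and "\<And>i. zs i \<in> V" "\<And>i. n (zs i) \<le> 1" "\<And>i. 1 - 1 / Suc i < f (zs i)"
  shows "(\<lambda>i. f (zs i)) \<longlonglongrightarrow> 1"
proof (rule real_tendsto_sandwich[of "\<lambda>i. 1 - 1 / Suc i" _ _ "\<lambda>i. 1"])
  show "\<forall>\<^sub>F i in sequentially. 1 - 1 / real (Suc i) \<le> f (zs i)"
    using assms(5) by (simp add: less_imp_le)
  show "\<forall>\<^sub>F i in sequentially. f (zs i) \<le> 1"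
    using dual_norm_upper[OF assms(1) assms(3,4)] assms(2) by (auto simp: abs_le_iff)
  show "(\<lambda>i. 1 - 1 / real (Suc i)) \<longlonglongrightarrow> 1"
    using tendsto_diff[OF tendsto_const LIMSEQ_inverse_real_of_nat] by (simp add: inverse_eq_divide)
qed simp

lemma strongly_exposing_norming_sequence:
  assumes "strongly_exposing f" "\<epsilon> > 0"
    and "\<And>i. zs i \<in> V" "\<And>i. n (zs i) \<le> 1" "\<And>i. 1 - 1 / Suc i < f (zs i)"
  obtains \<delta> M where "\<delta> > 0" "\<And>i. i \<ge> M \<Longrightarrow> 1 - \<delta> \<le> f (zs i)"
    "\<And>i w. i \<ge> M \<Longrightarrow> w \<in> V \<Longrightarrow> n w \<le> 1 \<Longrightarrow> 1 - \<delta> \<le> f w \<Longrightarrow> n (pl w (sc (-1) (zs i))) \<le> \<epsilon>"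
proof -
  obtain \<delta> where \<delta>: "\<delta> > 0" "\<forall>w\<in>V. \<forall>w'\<in>V. n w \<le> 1 \<longrightarrow> n w' \<le> 1 \<longrightarrow>
      1 - \<delta> \<le> f w \<longrightarrow> 1 - \<delta> \<le> f w' \<longrightarrow> n (pl w (sc (-1) w')) \<le> \<epsilon>"
    using assms(1,2) unfolding strongly_exposing_def by blast
  obtain M where M: "1 / Suc M < \<delta>"
    using reals_Archimedean[OF \<delta>(1)] by (auto simp: inverse_eq_divide)
  have fz: "1 - \<delta> \<le> f (zs i)" if "i \<ge> M" for i
  proof -
    have "1 / real (Suc i) \<le> 1 / Suc M" using that by (intro divide_left_mono) auto
    then show ?thesis using assms(5)[of i] M by linarith
  qed
  show ?thesis using that[OF \<delta>(1) fz] \<delta>(2) fz assms(3,4) by blast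
qed

lemma norming_sequence_convergent:
  assumes "strongly_exposing f" and h: "h \<in> dual_sp pl sc V n"
    and zs: "\<And>i. zs i \<in> V" "\<And>i. n (zs i) \<le> 1" "\<And>i. 1 - 1 / Suc i < f (zs i)"
  shows "convergent (\<lambda>i. h (zs i))"
proof -
  have "Cauchy (\<lambda>i. h (zs i))"
  proof (rule metric_CauchyI)
    fix e :: real assume e: "e > 0"
    have hn: "dual_norm V n h \<ge> 0" by (rule dual_norm_nonneg[OF dual_sp_bounded_functional[OF h]])
    define \<epsilon> where "\<epsilon> = e / (dual_norm V n h + 1)"
    have "\<epsilon> > 0" using e hn by (simp add: \<epsilon>_def)
    then obtain \<delta> M where M: "\<And>i. i \<ge> M \<Longrightarrow> 1 - \<delta> \<le> f (zs i)"
      "\<And>i w. i \<ge> M \<Longrightarrow> w \<in> V \<Longrightarrow> n w \<le> 1 \<Longrightarrow> 1 - \<delta> \<le> f w \<Longrightarrow> n (pl w (sc (-1) (zs i))) \<le> \<epsilon>"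
      using strongly_exposing_norming_sequence[OF assms(1) _ zs] by metis
    show "\<exists>M. \<forall>i\<ge>M. \<forall>j\<ge>M. dist (h (zs i)) (h (zs j)) < e"
    proof (intro exI allI impI)
      fix i j assume ij: "M \<le> i" "M \<le> j"
      have "\<bar>h (zs i) - h (zs j)\<bar> \<le> dual_norm V n h * n (pl (zs i) (sc (-1) (zs j)))"
        by (rule dual_sp_lipschitz[OF h zs(1) zs(1)])
      also have "\<dots> \<le> dual_norm V n h * \<epsilon>"
        using M ij zs by (intro mult_left_mono[OF _ hn]) auto
      also have "\<dots> < e" using e hn by (simp add: \<epsilon>_def field_simps)
      finally show "dist (h (zs i)) (h (zs j)) < e" by (simp add: dist_real_def)
    qed
  qed
  then show ?thesis by (simp add: Cauchy_convergent_iff)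
qed

text \<open>The derivative of the dual norm at a strongly exposing f is evaluation at the limit of any
  norming sequence; this is the estimate behind it.\<close>
lemma dual_norm_expansion_along_norming_sequence:
  assumes fb: "bounded_functional f" and f1: "dual_norm V n f = 1"
    and zs: "\<And>i. zs i \<in> V" "\<And>i. n (zs i) \<le> 1" and fzs: "(\<lambda>i. f (zs i)) \<longlonglongrightarrow> 1"
    and h: "h \<in> dual_sp pl sc V n" and hl: "(\<lambda>i. h (zs i)) \<longlonglongrightarrow> l"
    and \<epsilon>: "\<epsilon> \<ge> 0" and \<delta>: "\<delta> > 0"
    and close: "\<And>i w. i \<ge> M \<Longrightarrow> w \<in> V \<Longrightarrow> n w \<le> 1 \<Longrightarrow> 1 - \<delta> \<le> f w \<Longrightarrow> n (pl w (sc (-1) (zs i))) \<le> \<epsilon>"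
    and hs: "dual_norm V n h < \<delta> / 3"
  shows "\<bar>dual_norm V n (\<lambda>v. f v + h v) - dual_norm V n f - l\<bar> \<le> \<epsilon> * dual_norm V n h"
proof -
  define F where "F = (\<lambda>v. f v + h v)"
  have hb: "bounded_functional h" by (rule dual_sp_bounded_functional[OF h])
  have Fb: "bounded_functional F" unfolding F_def by (rule bounded_functional_add[OF fb hb])
  have hn: "dual_norm V n h \<ge> 0" by (rule dual_norm_nonneg[OF hb])
  have "dual_norm V n f \<le> dual_norm V n F + dual_norm V n (\<lambda>v. (-1) * h v)"
  proof -
    have "f = (\<lambda>v. F v + (-1) * h v)" unfolding F_def by auto
    then show ?thesis using dual_norm_triangle[OF Fb bounded_functional_scale[OF hb, of "-1"]] by simp
  qed
  then have lowF: "dual_norm V n F \<ge> 1 - dual_norm V n h" using dual_norm_scale[OF hb, of "-1"] f1 by simp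
  have lower: "1 + l \<le> dual_norm V n F"
  proof -
    have "(\<lambda>i. F (zs i)) \<longlonglongrightarrow> 1 + l" unfolding F_def by (rule tendsto_add[OF fzs hl])
    moreover have "F (zs i) \<le> dual_norm V n F" for i
      using dual_norm_upper[OF Fb zs(1) zs(2), of i] by linarith
    ultimately show ?thesis by (intro LIMSEQ_le_const2) auto
  qed
  have upper: "dual_norm V n F \<le> 1 + l + \<epsilon> * dual_norm V n h + \<eta>" if \<eta>: "\<eta> > 0" "\<eta> < \<delta> / 3" for \<eta>
  proof -
    obtain w where w: "w \<in> V" "n w \<le> 1" "dual_norm V n F - \<eta> < F w"
      using dual_norm_approx[OF Fb \<eta>(1)] by auto
    have hw: "\<bar>h w\<bar> \<le> dual_norm V n h" using dual_norm_upper[OF hb w(1) w(2)] .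
    have fw: "1 - \<delta> \<le> f w" using w(3) lowF hw \<eta> hs unfolding F_def by linarith
    have fw1: "f w \<le> 1" using dual_norm_upper[OF fb w(1,2)] f1 by simp
    have "dual_norm V n F - 1 - \<epsilon> * dual_norm V n h - \<eta> \<le> h (zs i)" if i: "i \<ge> M" for i
    proof -
      have "\<bar>h w - h (zs i)\<bar> \<le> dual_norm V n h * n (pl w (sc (-1) (zs i)))"
        by (rule dual_sp_lipschitz[OF h w(1) zs(1)])
      also have "\<dots> \<le> dual_norm V n h * \<epsilon>" using close[OF i w(1,2) fw] hn by (rule mult_left_mono)
      finally show ?thesis using w(3) fw1 unfolding F_def by (simp add: algebra_simps)
    qed
    then have "dual_norm V n F - 1 - \<epsilon> * dual_norm V n h - \<eta> \<le> l"
      by (intro LIMSEQ_le_const[OF hl]) auto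
    then show ?thesis by linarith
  qed
  have "dual_norm V n F \<le> 1 + l + \<epsilon> * dual_norm V n h"
  proof (rule field_le_epsilon)
    fix e :: real assume "e > 0"
    then show "dual_norm V n F \<le> 1 + l + \<epsilon> * dual_norm V n h + e"
      using upper[of "min e (\<delta> / 6)"] \<delta> by (cases "e \<le> \<delta> / 6") (auto simp: min_def)
  qed
  then show ?thesis using lower f1 \<epsilon> hn unfolding F_def by (simp add: abs_le_iff)
qed

text \<open>Smulyan's criterion, in the direction needed here.\<close>
lemma frechet_diff_dual_norm_if_strongly_exposing:
  assumes fb: "bounded_functional f" and f1: "dual_norm V n f = 1" and exp: "strongly_exposing f"
  shows "frechet_diff_dual_norm pl sc V n f"
proof -
  obtain zs where zs: "\<And>i. zs i \<in> V" "\<And>i. n (zs i) \<le> 1" "\<And>i. 1 - 1 / Suc i < f (zs i)"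
    using norming_sequence[OF fb f1] by blast
  define L where "L h = lim (\<lambda>i. h (zs i))" for h :: "'v \<Rightarrow> real"
  have Lt: "(\<lambda>i. h (zs i)) \<longlonglongrightarrow> L h" if "h \<in> dual_sp pl sc V n" for h
    using norming_sequence_convergent[OF exp that zs] unfolding L_def by (simp add: convergent_LIMSEQ_iff)
  show ?thesis unfolding frechet_diff_dual_norm_def
  proof (intro exI[of _ L] conjI ballI allI impI)
    fix g h assume g: "g \<in> dual_sp pl sc V n" and h: "h \<in> dual_sp pl sc V n"
    show "L (\<lambda>v. g v + h v) = L g + L h"
      using LIMSEQ_unique[OF Lt[OF dual_sp_add[OF g h]] tendsto_add[OF Lt[OF g] Lt[OF h]]] .
  next
    fix a g assume g: "g \<in> dual_sp pl sc V n"
    show "L (\<lambda>v. a * g v) = a * L g"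
      using LIMSEQ_unique[OF Lt[OF dual_sp_scale[OF g]] tendsto_mult_left[OF Lt[OF g]]] .
  next
    have "\<bar>L g\<bar> \<le> 1 * dual_norm V n g" if g: "g \<in> dual_sp pl sc V n" for g
      using dual_norm_upper[OF dual_sp_bounded_functional[OF g] zs(1,2)]
      by (intro LIMSEQ_le_const2[OF tendsto_rabs[OF Lt[OF g]]]) auto
    then show "\<exists>C. \<forall>g\<in>dual_sp pl sc V n. \<bar>L g\<bar> \<le> C * dual_norm V n g" by blast
  next
    fix \<epsilon> :: real assume \<epsilon>: "\<epsilon> > 0"
    obtain \<delta> M where \<delta>: "\<delta> > 0"
      and close: "\<And>i w. i \<ge> M \<Longrightarrow> w \<in> V \<Longrightarrow> n w \<le> 1 \<Longrightarrow> 1 - \<delta> \<le> f w \<Longrightarrow> n (pl w (sc (-1) (zs i))) \<le> \<epsilon>"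
      using strongly_exposing_norming_sequence[OF exp \<epsilon> zs] by metis
    have "\<bar>dual_norm V n (\<lambda>v. f v + h v) - dual_norm V n f - L h\<bar> \<le> \<epsilon> * dual_norm V n h"
      if h: "h \<in> dual_sp pl sc V n" and hs: "dual_norm V n h < \<delta> / 3" for h
      using dual_norm_expansion_along_norming_sequence[OF fb f1 zs(1,2)
          norming_sequence_tendsto[OF fb f1 zs] h Lt[OF h] _ \<delta> close hs] \<epsilon> by simp
    then show "\<exists>\<delta>>0. \<forall>h\<in>dual_sp pl sc V n. dual_norm V n h < \<delta> \<longrightarrow>
        \<bar>dual_norm V n (\<lambda>v. f v + h v) - dual_norm V n f - L h\<bar> \<le> \<epsilon> * dual_norm V n h"
      using \<delta> by (intro exI[of _ "\<delta> / 3"]) auto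
  qed
qed

lemma le_if_le_plus_mult_epsilon:
  fixes x y c :: real
  assumes c: "c \<ge> 0" and le: "\<And>\<epsilon>. \<epsilon> > 0 \<Longrightarrow> x \<le> y + \<epsilon> * c"
  shows "x \<le> y"
proof (rule field_le_epsilon)
  fix e :: real assume e: "e > 0"
  have "x \<le> y + e / (c + 1) * c" by (rule le) (use e c in simp)
  also have "e / (c + 1) * c \<le> e" using e c by (simp add: field_simps)
  finally show "x \<le> y + e" by simp
qed

lemma frechet_estimate_small_multiple:
  assumes Lsc: "\<forall>c. \<forall>g\<in>dual_sp pl sc V n. L (\<lambda>v. c * g v) = c * L g"
    and Fr: "\<forall>\<epsilon>>0. \<exists>\<delta>>0. \<forall>h\<in>dual_sp pl sc V n. dual_norm V n h < \<delta> \<longrightarrow>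
      \<bar>dual_norm V n (\<lambda>v. \<phi> v + h v) - dual_norm V n \<phi> - L h\<bar> \<le> \<epsilon> * dual_norm V n h"
    and h: "h \<in> dual_sp pl sc V n" and \<epsilon>: "\<epsilon> > 0"
  obtains \<tau> where "0 < \<tau>" "\<tau> < 1"
    "\<bar>dual_norm V n (\<lambda>v. \<phi> v + \<tau> * h v) - dual_norm V n \<phi> - \<tau> * L h\<bar> \<le> \<epsilon> * (\<tau> * dual_norm V n h)"
proof -
  have hb: "bounded_functional h" by (rule dual_sp_bounded_functional[OF h])
  have hn: "dual_norm V n h \<ge> 0" by (rule dual_norm_nonneg[OF hb])
  obtain \<delta> where \<delta>: "\<delta> > 0" "\<forall>h\<in>dual_sp pl sc V n. dual_norm V n h < \<delta> \<longrightarrow>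
      \<bar>dual_norm V n (\<lambda>v. \<phi> v + h v) - dual_norm V n \<phi> - L h\<bar> \<le> \<epsilon> * dual_norm V n h"
    using Fr \<epsilon> by blast
  define \<tau> where "\<tau> = min (1/2) (\<delta> / (2 * (dual_norm V n h + 1)))"
  have \<tau>: "0 < \<tau>" "\<tau> < 1" using \<delta> hn by (auto simp: \<tau>_def)
  have norm_\<tau>h: "dual_norm V n (\<lambda>v. \<tau> * h v) = \<tau> * dual_norm V n h"
    using dual_norm_scale[OF hb, of \<tau>] \<tau> by simp
  have "\<tau> * dual_norm V n h \<le> \<delta> / (2 * (dual_norm V n h + 1)) * (dual_norm V n h + 1)"
    using \<tau> hn by (intro mult_mono) (auto simp: \<tau>_def)
  also have "\<dots> = \<delta> / 2"
    using hn by (simp add: divide_simps)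
  also have "\<dots> < \<delta>" using \<delta> by simp
  finally have "dual_norm V n (\<lambda>v. \<tau> * h v) < \<delta>" using norm_\<tau>h by simp
  then show ?thesis
    using that[OF \<tau>] \<delta>(2) dual_sp_scale[OF h, of \<tau>] norm_\<tau>h Lsc h by auto
qed

lemma frechet_deriv_le_dual_norm:
  assumes Lsc: "\<forall>c. \<forall>g\<in>dual_sp pl sc V n. L (\<lambda>v. c * g v) = c * L g"
    and Fr: "\<forall>\<epsilon>>0. \<exists>\<delta>>0. \<forall>h\<in>dual_sp pl sc V n. dual_norm V n h < \<delta> \<longrightarrow>
      \<bar>dual_norm V n (\<lambda>v. \<phi> v + h v) - dual_norm V n \<phi> - L h\<bar> \<le> \<epsilon> * dual_norm V n h"
    and \<phi>: "\<phi> \<in> dual_sp pl sc V n" and h: "h \<in> dual_sp pl sc V n"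
  shows "L h \<le> dual_norm V n h"
proof (rule le_if_le_plus_mult_epsilon)
  have hb: "bounded_functional h" by (rule dual_sp_bounded_functional[OF h])
  show "dual_norm V n h \<ge> 0" by (rule dual_norm_nonneg[OF hb])
  fix \<epsilon> :: real assume \<epsilon>: "\<epsilon> > 0"
  obtain \<tau> where \<tau>: "0 < \<tau>"
    and est: "\<bar>dual_norm V n (\<lambda>v. \<phi> v + \<tau> * h v) - dual_norm V n \<phi> - \<tau> * L h\<bar> \<le> \<epsilon> * (\<tau> * dual_norm V n h)"
    using frechet_estimate_small_multiple[OF Lsc Fr h \<epsilon>] by blast
  have "dual_norm V n (\<lambda>v. \<phi> v + \<tau> * h v) \<le> dual_norm V n \<phi> + \<tau> * dual_norm V n h"
    using dual_norm_triangle[OF dual_sp_bounded_functional[OF \<phi>] bounded_functional_scale[OF hb, of \<tau>]]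
      dual_norm_scale[OF hb, of \<tau>] \<tau> by simp
  with est have "\<tau> * L h \<le> \<tau> * (dual_norm V n h + \<epsilon> * dual_norm V n h)"
    by (simp add: abs_le_iff algebra_simps)
  then show "L h \<le> dual_norm V n h + \<epsilon> * dual_norm V n h" using \<tau> by simp
qed

lemma dual_norm_le_frechet_deriv:
  assumes Lsc: "\<forall>c. \<forall>g\<in>dual_sp pl sc V n. L (\<lambda>v. c * g v) = c * L g"
    and Fr: "\<forall>\<epsilon>>0. \<exists>\<delta>>0. \<forall>h\<in>dual_sp pl sc V n. dual_norm V n h < \<delta> \<longrightarrow>
      \<bar>dual_norm V n (\<lambda>v. \<phi> v + h v) - dual_norm V n \<phi> - L h\<bar> \<le> \<epsilon> * dual_norm V n h"
    and \<phi>: "\<phi> \<in> dual_sp pl sc V n"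
  shows "dual_norm V n \<phi> \<le> L \<phi>"
proof (rule le_if_le_plus_mult_epsilon)
  have \<phi>b: "bounded_functional \<phi>" by (rule dual_sp_bounded_functional[OF \<phi>])
  show "dual_norm V n \<phi> \<ge> 0" by (rule dual_norm_nonneg[OF \<phi>b])
  fix \<epsilon> :: real assume \<epsilon>: "\<epsilon> > 0"
  have minus_\<phi>: "(\<lambda>v. (-1) * \<phi> v) \<in> dual_sp pl sc V n" by (rule dual_sp_scale[OF \<phi>])
  obtain \<tau> where \<tau>: "0 < \<tau>" "\<tau> < 1"
    and est: "\<bar>dual_norm V n (\<lambda>v. \<phi> v + \<tau> * ((-1) * \<phi> v)) - dual_norm V n \<phi> - \<tau> * L (\<lambda>v. (-1) * \<phi> v)\<bar>
      \<le> \<epsilon> * (\<tau> * dual_norm V n (\<lambda>v. (-1) * \<phi> v))"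
    using frechet_estimate_small_multiple[OF Lsc Fr minus_\<phi> \<epsilon>] by blast
  have "(\<lambda>v. \<phi> v + \<tau> * ((-1) * \<phi> v)) = (\<lambda>v. (1 - \<tau>) * \<phi> v)" by (auto simp: algebra_simps)
  then have "dual_norm V n (\<lambda>v. \<phi> v + \<tau> * ((-1) * \<phi> v)) = (1 - \<tau>) * dual_norm V n \<phi>"
    using dual_norm_scale[OF \<phi>b, of "1 - \<tau>"] \<tau> by simp
  moreover have "dual_norm V n (\<lambda>v. (-1) * \<phi> v) = dual_norm V n \<phi>"
    using dual_norm_scale[OF \<phi>b, of "-1"] by simp
  moreover have "L (\<lambda>v. (-1) * \<phi> v) = - L \<phi>" using Lsc \<phi> by (metis mult_minus1)
  ultimately have "\<tau> * dual_norm V n \<phi> \<le> \<tau> * (L \<phi> + \<epsilon> * dual_norm V n \<phi>)"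
    using est by (simp add: abs_le_iff algebra_simps)
  then show "dual_norm V n \<phi> \<le> L \<phi> + \<epsilon> * dual_norm V n \<phi>" using \<tau> by simp
qed

definition supporting_derivative :: "('v \<Rightarrow> real) \<Rightarrow> (('v \<Rightarrow> real) \<Rightarrow> real) \<Rightarrow> bool" where
  "supporting_derivative \<phi> L \<longleftrightarrow>
     (\<forall>g\<in>dual_sp pl sc V n. \<forall>h\<in>dual_sp pl sc V n. L (\<lambda>v. g v + h v) = L g + L h) \<and>
     (\<forall>c. \<forall>g\<in>dual_sp pl sc V n. L (\<lambda>v. c * g v) = c * L g) \<and>
     (\<forall>h\<in>dual_sp pl sc V n. \<bar>L h\<bar> \<le> dual_norm V n h) \<and> dual_norm V n \<phi> \<le> L \<phi> \<and>
     (\<forall>\<epsilon>>0. \<exists>\<delta>>0. \<forall>h\<in>dual_sp pl sc V n. dual_norm V n h < \<delta> \<longrightarrow>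
        dual_norm V n (\<lambda>v. \<phi> v + h v) \<le> dual_norm V n \<phi> + L h + \<epsilon> * dual_norm V n h)"

lemma supporting_derivative_if_frechet_diff:
  assumes \<phi>: "\<phi> \<in> dual_sp pl sc V n" and fr: "frechet_diff_dual_norm pl sc V n \<phi>"
  obtains L where "supporting_derivative \<phi> L"
proof -
  obtain L where Ladd: "\<forall>g\<in>dual_sp pl sc V n. \<forall>h\<in>dual_sp pl sc V n. L (\<lambda>v. g v + h v) = L g + L h"
    and Lsc: "\<forall>c. \<forall>g\<in>dual_sp pl sc V n. L (\<lambda>v. c * g v) = c * L g"
    and Fr: "\<forall>\<epsilon>>0. \<exists>\<delta>>0. \<forall>h\<in>dual_sp pl sc V n. dual_norm V n h < \<delta> \<longrightarrow>
      \<bar>dual_norm V n (\<lambda>v. \<phi> v + h v) - dual_norm V n \<phi> - L h\<bar> \<le> \<epsilon> * dual_norm V n h"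
    using fr unfolding frechet_diff_dual_norm_def by blast
  have "\<bar>L h\<bar> \<le> dual_norm V n h" if h: "h \<in> dual_sp pl sc V n" for h
  proof -
    have "L (\<lambda>v. (-1) * h v) \<le> dual_norm V n (\<lambda>v. (-1) * h v)"
      by (rule frechet_deriv_le_dual_norm[OF Lsc Fr \<phi> dual_sp_scale[OF h]])
    moreover have "L (\<lambda>v. (-1) * h v) = - L h" using Lsc h by (metis mult_minus1)
    ultimately have "- L h \<le> dual_norm V n h"
      using dual_norm_scale[OF dual_sp_bounded_functional[OF h], of "-1"] by simp
    then show ?thesis using frechet_deriv_le_dual_norm[OF Lsc Fr \<phi> h] by (simp add: abs_le_iff)
  qed
  moreover have "\<forall>\<epsilon>>0. \<exists>\<delta>>0. \<forall>h\<in>dual_sp pl sc V n. dual_norm V n h < \<delta> \<longrightarrow>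
      dual_norm V n (\<lambda>v. \<phi> v + h v) \<le> dual_norm V n \<phi> + L h + \<epsilon> * dual_norm V n h"
    using Fr by (fastforce simp: abs_le_iff)
  ultimately show ?thesis
    using that Ladd Lsc dual_norm_le_frechet_deriv[OF Lsc Fr \<phi>] unfolding supporting_derivative_def by blast
qed

lemma supporting_derivativeD:
  assumes "supporting_derivative \<phi> L"
  shows "\<And>g h. g \<in> dual_sp pl sc V n \<Longrightarrow> h \<in> dual_sp pl sc V n \<Longrightarrow> L (\<lambda>v. g v + h v) = L g + L h"
    and "\<And>c g. g \<in> dual_sp pl sc V n \<Longrightarrow> L (\<lambda>v. c * g v) = c * L g"
    and "\<And>h. h \<in> dual_sp pl sc V n \<Longrightarrow> \<bar>L h\<bar> \<le> dual_norm V n h"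
    and "dual_norm V n \<phi> \<le> L \<phi>"
    and "\<And>\<epsilon>. \<epsilon> > 0 \<Longrightarrow> \<exists>\<delta>>0. \<forall>h\<in>dual_sp pl sc V n. dual_norm V n h < \<delta> \<longrightarrow>
           dual_norm V n (\<lambda>v. \<phi> v + h v) \<le> dual_norm V n \<phi> + L h + \<epsilon> * dual_norm V n h"
  using assms unfolding supporting_derivative_def by blast+

end

section \<open>The l2-sum Sigma(X \<oplus> Y_k) and its norm\<close>

locale sigma_setting =
  fixes Yset :: "nat \<Rightarrow> 'y::real_vector set"
    and N :: "nat \<Rightarrow> 'x::banach \<times> 'y \<Rightarrow> real"
  assumes Ysub: "\<And>k. subspace (Yset k)"
    and Nnorm: "\<And>k. is_norm_on (UNIV \<times> Yset k) (N k)"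
    and NX: "\<And>k x. N k (x, 0) = norm x"
    and Nmono: "\<And>k x y. y \<in> Yset k \<Longrightarrow> N k (x, y) \<ge> norm x"
begin

abbreviation "Z k \<equiv> (UNIV :: 'x set) \<times> Yset k"
abbreviation "DN k \<equiv> dual_norm (Z k) (N k)"
abbreviation "P k \<equiv> pair_fun (Yset k)"

lemma Y_zero: "0 \<in> Yset k" using Ysub subspace_0 by blast
lemma Y_add: "y \<in> Yset k \<Longrightarrow> y' \<in> Yset k \<Longrightarrow> y + y' \<in> Yset k" using Ysub subspace_add by blast
lemma Y_scale: "y \<in> Yset k \<Longrightarrow> c *\<^sub>R y \<in> Yset k" using Ysub subspace_scale by blast

lemma N_nonneg: "y \<in> Yset k \<Longrightarrow> 0 \<le> N k (x, y)"
  using Nnorm[of k] unfolding is_norm_on_def by auto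
lemma N_sc: "y \<in> Yset k \<Longrightarrow> N k (c *\<^sub>R (x, y)) = \<bar>c\<bar> * N k (x, y)"
  using Nnorm[of k] unfolding is_norm_on_def by auto
lemma N_tri: "y \<in> Yset k \<Longrightarrow> y' \<in> Yset k \<Longrightarrow> N k ((x, y) + (x', y')) \<le> N k (x, y) + N k (x', y')"
  using Nnorm[of k] unfolding is_norm_on_def by auto

lemma N_0_le: assumes "y \<in> Yset k" shows "N k (0, y) \<le> 2 * N k (x, y)"
proof -
  have "N k (0, y) = N k ((x, y) + (-x, 0))" by simp
  also have "\<dots> \<le> N k (x, y) + N k (-x, 0)" using N_tri[OF assms Y_zero] .
  also have "\<dots> \<le> 2 * N k (x, y)" using NX[of k "-x"] Nmono[OF assms, of x] by simp
  finally show ?thesis .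
qed

lemma Ynorm_nonneg: "y \<in> Yset k \<Longrightarrow> 0 \<le> Ynorm N k y"
  unfolding Ynorm_def by (rule N_nonneg)

abbreviation "ZD k \<equiv> dual_sp (+) (*\<^sub>R) (Z k) (N k)"

sublocale Z: normed_subset "(+)" "(*\<^sub>R)" "Z k" "N k"
proof
  fix u v assume "u \<in> Z k" "v \<in> Z k"
  then show "u + v \<in> Z k" using Y_add by (cases u, cases v) auto
next
  fix c v assume v: "v \<in> Z k"
  then show "c *\<^sub>R v \<in> Z k" using Y_scale by (cases v) auto
  show "N k (c *\<^sub>R v) = \<bar>c\<bar> * N k v" using v N_sc by (cases v) auto
next
  fix v assume v: "v \<in> Z k" then show "0 \<le> N k v" using N_nonneg by (cases v) auto
qed (use Y_zero in auto)

definition y_functional :: "nat \<Rightarrow> ('y \<Rightarrow> real) \<Rightarrow> real \<Rightarrow> bool" where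
  "y_functional k u b \<longleftrightarrow> 0 \<le> b \<and> (\<forall>y. y \<notin> Yset k \<longrightarrow> u y = 0) \<and>
     (\<forall>y\<in>Yset k. \<forall>y'\<in>Yset k. u (y + y') = u y + u y') \<and> (\<forall>c. \<forall>y\<in>Yset k. u (c *\<^sub>R y) = c * u y) \<and>
     (\<forall>y\<in>Yset k. \<bar>u y\<bar> \<le> b * Ynorm N k y)"

lemma y_functional_0: "y_functional k u b \<Longrightarrow> u 0 = 0"
  unfolding y_functional_def using Y_zero[of k] by (metis mult_zero_left scale_zero_left)

lemma y_functional_zero: "b \<ge> 0 \<Longrightarrow> y_functional k (\<lambda>_. 0) b" unfolding y_functional_def using Ynorm_nonneg by auto

lemma y_functional_mono: "y_functional k u b \<Longrightarrow> b \<le> b' \<Longrightarrow> y_functional k u b'"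
proof -
  assume a: "y_functional k u b" "b \<le> b'"
  have "\<bar>u y\<bar> \<le> b' * Ynorm N k y" if "y \<in> Yset k" for y
  proof -
    have "\<bar>u y\<bar> \<le> b * Ynorm N k y" using a that unfolding y_functional_def by auto
    also have "\<dots> \<le> b' * Ynorm N k y" using a(2) Ynorm_nonneg[OF that] by (rule mult_right_mono)
    finally show ?thesis .
  qed
  then show ?thesis using a unfolding y_functional_def by auto
qed

lemma y_functional_lin: assumes "y_functional k u b" "y_functional k u' b'"
  shows "y_functional k (\<lambda>y. c * u y + c' * u' y) (\<bar>c\<bar> * b + \<bar>c'\<bar> * b')"
proof -
  have "\<bar>c * u y + c' * u' y\<bar> \<le> (\<bar>c\<bar> * b + \<bar>c'\<bar> * b') * Ynorm N k y" if "y \<in> Yset k" for y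
  proof -
    have "\<bar>c * u y + c' * u' y\<bar> \<le> \<bar>c\<bar> * \<bar>u y\<bar> + \<bar>c'\<bar> * \<bar>u' y\<bar>"
      by (metis abs_mult abs_triangle_ineq)
    also have "\<dots> \<le> \<bar>c\<bar> * (b * Ynorm N k y) + \<bar>c'\<bar> * (b' * Ynorm N k y)"
      using assms that unfolding y_functional_def by (intro add_mono mult_left_mono) auto
    finally show ?thesis by (simp add: algebra_simps)
  qed
  then show ?thesis using assms unfolding y_functional_def by (auto simp: algebra_simps)
qed

lemma y_functional_dual: "u \<in> dual_sp (+) (*\<^sub>R) (Yset k) (Ynorm N k) \<Longrightarrow> \<exists>b\<ge>0. y_functional k u b"
proof -
  assume u: "u \<in> dual_sp (+) (*\<^sub>R) (Yset k) (Ynorm N k)"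
  then obtain C where C: "\<forall>v\<in>Yset k. \<bar>u v\<bar> \<le> C * Ynorm N k v" unfolding dual_sp_def by auto
  have "\<forall>v\<in>Yset k. \<bar>u v\<bar> \<le> max C 0 * Ynorm N k v"
    using C Ynorm_nonneg by (meson max.cobounded1 mult_right_mono order_trans)
  then show ?thesis using u unfolding dual_sp_def lin_fun_on_def y_functional_def
    by (intro exI[of _ "max C 0"]) auto
qed

lemma y_functional_dual_sp: "y_functional k u b \<Longrightarrow> u \<in> dual_sp (+) (*\<^sub>R) (Yset k) (Ynorm N k)"
  unfolding dual_sp_def lin_fun_on_def y_functional_def by auto

lemma pair_fun_eq: "y \<in> Yset k \<Longrightarrow> P k g u (x, y) = g x + u y"
  unfolding pair_fun_def by simp
lemma pair_fun_out: "y \<notin> Yset k \<Longrightarrow> P k g u (x, y) = 0"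
  unfolding pair_fun_def by simp

lemma pair_fun_bound: assumes g: "bounded_linear g" and u: "y_functional k u b" and y: "y \<in> Yset k"
  shows "\<bar>P k g u (x, y)\<bar> \<le> (onorm g + 2 * b) * N k (x, y)"
proof -
  have b: "b \<ge> 0" using u unfolding y_functional_def by auto
  have "\<bar>P k g u (x, y)\<bar> \<le> \<bar>g x\<bar> + \<bar>u y\<bar>" using y by (simp add: pair_fun_eq abs_triangle_ineq)
  also have "\<bar>g x\<bar> \<le> onorm g * N k (x, y)"
  proof -
    have "\<bar>g x\<bar> \<le> onorm g * norm x" using onorm[OF g, of x] by simp
    also have "\<dots> \<le> onorm g * N k (x, y)" using Nmono[OF y, of x] onorm_pos_le[OF g] by (rule mult_left_mono)
    finally show ?thesis .
  qed
  also have "\<bar>u y\<bar> \<le> b * (2 * N k (x, y))"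
  proof -
    have "\<bar>u y\<bar> \<le> b * N k (0, y)" using u y unfolding y_functional_def Ynorm_def by auto
    also have "\<dots> \<le> b * (2 * N k (x, y))" using N_0_le[OF y, of x] b by (rule mult_left_mono)
    finally show ?thesis .
  qed
  finally show ?thesis by (simp add: algebra_simps)
qed

lemma pair_fun_linear: assumes g: "bounded_linear g" and u: "y_functional k u b"
  shows "lin_fun_on (+) (*\<^sub>R) (Z k) (P k g u)"
proof -
  interpret g: bounded_linear g by fact
  show ?thesis using u unfolding lin_fun_on_def y_functional_def pair_fun_def
    by (auto simp: Y_add Y_scale g.add g.scale distrib_left)
qed

lemma pair_fun_bounded: assumes g: "bounded_linear g" and u: "y_functional k u b"
  shows "Z.bounded_functional k (P k g u)"
proof -
  have "\<forall>v\<in>Z k. \<bar>P k g u v\<bar> \<le> (onorm g + 2 * b) * N k v" using pair_fun_bound[OF g u] by auto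
  then show ?thesis using pair_fun_linear[OF g u] unfolding Z.bounded_functional_def lin_fun_on_def by blast
qed

lemma pair_fun_dual: assumes g: "bounded_linear g" and u: "y_functional k u b"
  shows "P k g u \<in> dual_sp (+) (*\<^sub>R) (Z k) (N k)"
proof -
  have "\<forall>v\<in>Z k. \<bar>P k g u v\<bar> \<le> (onorm g + 2 * b) * N k v" using pair_fun_bound[OF g u] by auto
  then show ?thesis using pair_fun_linear[OF g u] unfolding dual_sp_def by (auto simp: pair_fun_out)
qed

lemma pair_fun_x_bounded: "bounded_linear g \<Longrightarrow> Z.bounded_functional k (P k g (\<lambda>_. 0))"
  by (rule pair_fun_bounded[OF _ y_functional_zero[of 0]]) auto
lemma pair_fun_y_bounded: "y_functional k u b \<Longrightarrow> Z.bounded_functional k (P k (\<lambda>_. 0) u)"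
  by (rule pair_fun_bounded[OF _ _]) auto
lemma pair_fun_x_dual: "bounded_linear g \<Longrightarrow> P k g (\<lambda>_. 0) \<in> ZD k"
  by (rule pair_fun_dual[OF _ y_functional_zero[of 0]]) auto
lemma pair_fun_y_dual: "y_functional k u b \<Longrightarrow> P k (\<lambda>_. 0) u \<in> ZD k"
  by (rule pair_fun_dual[OF _ _]) auto

lemma pair_fun_scale: "P k (\<lambda>x. c * g x) (\<lambda>y. c * u y) = (\<lambda>v. c * P k g u v)"
  unfolding pair_fun_def by (auto simp: algebra_simps)

lemma pair_fun_split: "P k g u = (\<lambda>v. P k g (\<lambda>_. 0) v + P k (\<lambda>_. 0) u v)"
  unfolding pair_fun_def by auto

lemma dual_norm_pair_fun_x: assumes g: "bounded_linear g" shows "DN k (P k g (\<lambda>_. 0)) \<le> onorm g"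
proof (rule Z.dual_norm_least)
  fix v assume v: "v \<in> Z k" "N k v \<le> 1"
  obtain x y where xy: "v = (x, y)" by fastforce
  have y: "y \<in> Yset k" using v xy by auto
  have "\<bar>P k g (\<lambda>_. 0) (x, y)\<bar> \<le> (onorm g + 2 * 0) * N k (x, y)"
    by (rule pair_fun_bound[OF g y_functional_zero y]) simp
  also have "\<dots> = onorm g * N k (x, y)" by simp
  also have "\<dots> \<le> onorm g * 1" using v xy onorm_pos_le[OF g] by (intro mult_left_mono) auto
  finally show "\<bar>P k g (\<lambda>_. 0) v\<bar> \<le> onorm g" using xy by simp
qed

lemma dual_norm_pair_fun_y: assumes u: "y_functional k u b" and b: "b \<ge> 0" shows "DN k (P k (\<lambda>_. 0) u) \<le> 2 * b"
proof (rule Z.dual_norm_least)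
  fix v assume v: "v \<in> Z k" "N k v \<le> 1"
  obtain x y where xy: "v = (x, y)" by fastforce
  have y: "y \<in> Yset k" using v xy by auto
  have bl: "bounded_linear (\<lambda>_::'x. 0::real)" by simp
  have "\<bar>P k (\<lambda>_. 0) u (x, y)\<bar> \<le> (onorm (\<lambda>_::'x. 0::real) + 2 * b) * N k (x, y)"
    by (rule pair_fun_bound[OF bl u y])
  also have "\<dots> = (2 * b) * N k (x, y)" by (simp add: onorm_zero)
  also have "\<dots> \<le> (2 * b) * 1" using v xy b by (intro mult_left_mono) auto
  finally show "\<bar>P k (\<lambda>_. 0) u v\<bar> \<le> 2 * b" using xy by simp
qed

lemma dual_norm_pair_fun_le:
  assumes g: "bounded_linear g" and u: "y_functional k u b"
  shows "DN k (P k g u) \<le> onorm g + 2 * b"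
proof -
  have "DN k (P k g u) \<le> DN k (P k g (\<lambda>_. 0)) + DN k (P k (\<lambda>_. 0) u)"
    by (subst pair_fun_split) (rule Z.dual_norm_triangle[OF pair_fun_x_bounded[OF g] pair_fun_y_bounded[OF u]])
  then show ?thesis
    using dual_norm_pair_fun_x[OF g, of k] dual_norm_pair_fun_y[OF u] u unfolding y_functional_def by linarith
qed

lemma pair_fun_dual_norm_le_1_D:
  assumes g: "bounded_linear g" and u: "y_functional k u b" and d: "DN k (P k g u) \<le> 1"
  shows "onorm g \<le> 1" and "y_functional k u 1"
proof -
  have bnd: "Z.bounded_functional k (P k g u)" by (rule pair_fun_bounded[OF g u])
  have "norm (g x) \<le> 1 * norm x" for x
  proof -
    have "\<bar>P k g u (x, 0)\<bar> \<le> DN k (P k g u) * N k (x, 0)" using Z.dual_norm_bound[OF bnd] Y_zero by auto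
    also have "\<dots> \<le> 1 * norm x" unfolding NX using d by (intro mult_right_mono) auto
    moreover have "P k g u (x, 0) = g x" using Y_zero y_functional_0[OF u] by (auto simp: pair_fun_eq)
    ultimately show ?thesis by simp
  qed
  then show "onorm g \<le> 1" by (intro onorm_bound) auto
  have "\<bar>u y\<bar> \<le> 1 * Ynorm N k y" if "y \<in> Yset k" for y
  proof -
    have "\<bar>P k g u (0, y)\<bar> \<le> DN k (P k g u) * N k (0, y)" using Z.dual_norm_bound[OF bnd] that by auto
    also have "\<dots> \<le> 1 * N k (0, y)" using d N_nonneg[OF that] by (intro mult_right_mono) auto
    moreover have "P k g u (0, y) = u y" using that linear_0[OF bounded_linear.linear[OF g]] by (simp add: pair_fun_eq)
    ultimately show ?thesis by (simp add: Ynorm_def)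
  qed
  then show "y_functional k u 1" using u unfolding y_functional_def by auto
qed

abbreviation "SS \<equiv> SigmaSet Yset N"
abbreviation "Lam \<equiv> in_Lambda Yset N"
abbreviation "lam \<equiv> lam_fun Yset N"
abbreviation "snorm \<equiv> sigma_norm Yset N"
abbreviation "Yn k y \<equiv> Ynorm N k y"

lemma SigmaSet_iff: "(x, y) \<in> SS \<longleftrightarrow> (\<forall>k. y k \<in> Yset k) \<and> summable (\<lambda>k. (Yn k (y k))\<^sup>2)"
  unfolding SigmaSet_def by auto

lemma in_Lambda_D: assumes "Lam g \<beta> u"
  shows "bounded_linear g" "onorm g \<le> 1" "\<And>k. y_functional k (u k) 1" "\<And>k. 0 \<le> \<beta> k" "\<And>k. \<beta> k \<le> 1"
    "summable (\<lambda>k. (\<beta> k)\<^sup>2)" "(\<Sum>k. (\<beta> k)\<^sup>2) \<le> 1" "\<And>k. DN k (P k g (u k)) \<le> 1"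
proof -
  show g: "bounded_linear g" using assms unfolding in_Lambda_def by auto
  show d: "\<And>k. DN k (P k g (u k)) \<le> 1" using assms unfolding in_Lambda_def by auto
  have "\<And>k. \<exists>b. y_functional k (u k) b" using assms y_functional_dual unfolding in_Lambda_def by blast
  then show "\<And>k. y_functional k (u k) 1" using pair_fun_dual_norm_le_1_D(2)[OF g _ d] by blast
  show "onorm g \<le> 1" using pair_fun_dual_norm_le_1_D(1)[OF g _ d] \<open>\<And>k. \<exists>b. y_functional k (u k) b\<close> by blast
  show "\<And>k. 0 \<le> \<beta> k" "\<And>k. \<beta> k \<le> 1" "summable (\<lambda>k. (\<beta> k)\<^sup>2)" "(\<Sum>k. (\<beta> k)\<^sup>2) \<le> 1"
    using assms unfolding in_Lambda_def by auto
qed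

lemma lam_fun_eq: "(x, y) \<in> SS \<Longrightarrow> lam g \<beta> u (x, y) = g x + (\<Sum>k. \<beta> k * u k (y k))"
  unfolding lam_fun_def by simp

lemma lam_fun_out: "z \<notin> SS \<Longrightarrow> lam g \<beta> u z = 0"
  unfolding lam_fun_def by (cases z) auto

lemma weighted_series:
  assumes yS: "(x, y) \<in> SS" and w: "summable (\<lambda>k. (w k)\<^sup>2)"
    and u: "\<And>k. y_functional k (u k) b"
  shows "summable (\<lambda>k. w k * u k (y k))"
    and "\<bar>\<Sum>k. w k * u k (y k)\<bar> \<le> b * (((\<Sum>k. (w k)\<^sup>2) + (\<Sum>k. (Yn k (y k))\<^sup>2)) / 2)"
proof -
  have b: "b \<ge> 0" using u[of 0] unfolding y_functional_def by auto
  have yk: "y k \<in> Yset k" for k using yS by (simp add: SigmaSet_iff)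
  have Y: "summable (\<lambda>k. (Yn k (y k))\<^sup>2)" using yS by (simp add: SigmaSet_iff)
  note pq = summable_prod_abs[OF w Y]
  have le: "\<bar>w k * u k (y k)\<bar> \<le> b * \<bar>w k * Yn k (y k)\<bar>" for k
  proof -
    have "\<bar>u k (y k)\<bar> \<le> b * Yn k (y k)" using u[of k] yk[of k] unfolding y_functional_def by auto
    then have "\<bar>w k\<bar> * \<bar>u k (y k)\<bar> \<le> \<bar>w k\<bar> * (b * Yn k (y k))" by (rule mult_left_mono) simp
    then show ?thesis using Ynorm_nonneg[OF yk[of k]] b by (simp add: abs_mult algebra_simps)
  qed
  have s2: "summable (\<lambda>k. b * \<bar>w k * Yn k (y k)\<bar>)" using pq(1) by (rule summable_mult)
  show s: "summable (\<lambda>k. w k * u k (y k))"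
    by (rule summable_comparison_test[OF _ s2]) (use le in auto)
  have "\<bar>\<Sum>k. w k * u k (y k)\<bar> \<le> (\<Sum>k. \<bar>w k * u k (y k)\<bar>)"
    by (rule summable_rabs[OF summable_comparison_test[OF _ s2]]) (use le in auto)
  also have "\<dots> \<le> (\<Sum>k. b * \<bar>w k * Yn k (y k)\<bar>)"
    by (intro suminf_le s2 le summable_comparison_test[OF _ s2]) (use le in auto)
  also have "\<dots> = b * (\<Sum>k. \<bar>w k * Yn k (y k)\<bar>)" using pq(1) by (rule suminf_mult)
  also have "\<dots> \<le> b * (((\<Sum>k. (w k)\<^sup>2) + (\<Sum>k. (Yn k (y k))\<^sup>2)) / 2)"
    using pq(2) b by (rule mult_left_mono)
  finally show "\<bar>\<Sum>k. w k * u k (y k)\<bar> \<le> b * (((\<Sum>k. (w k)\<^sup>2) + (\<Sum>k. (Yn k (y k))\<^sup>2)) / 2)" .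
qed

lemma lam_fun_bound: assumes L: "Lam g \<beta> u" and z: "(x, y) \<in> SS"
  shows "\<bar>lam g \<beta> u (x, y)\<bar> \<le> norm x + (1 + (\<Sum>k. (Yn k (y k))\<^sup>2)) / 2"
proof -
  note LamD = in_Lambda_D[OF L]
  have "\<bar>lam g \<beta> u (x, y)\<bar> \<le> \<bar>g x\<bar> + \<bar>\<Sum>k. \<beta> k * u k (y k)\<bar>"
    using z by (simp add: lam_fun_eq abs_triangle_ineq)
  also have "\<bar>g x\<bar> \<le> norm x"
  proof -
    have "\<bar>g x\<bar> \<le> onorm g * norm x" using onorm[OF LamD(1)] by simp
    also have "\<dots> \<le> 1 * norm x" using LamD(2) by (intro mult_right_mono) auto
    finally show ?thesis by simp
  qed
  also have "\<bar>\<Sum>k. \<beta> k * u k (y k)\<bar> \<le> 1 * (((\<Sum>k. (\<beta> k)\<^sup>2) + (\<Sum>k. (Yn k (y k))\<^sup>2)) / 2)"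
    by (rule weighted_series(2)[OF z LamD(6) LamD(3)])
  also have "\<dots> \<le> (1 + (\<Sum>k. (Yn k (y k))\<^sup>2)) / 2" using LamD(7) by simp
  finally show ?thesis by simp
qed

lemma in_Lambda_zero: "Lam (\<lambda>_. 0) (\<lambda>_. 0) (\<lambda>_ _. 0)"
proof -
  have "DN k (P k (\<lambda>_. 0) (\<lambda>_. 0)) \<le> 1" for k
    by (rule Z.dual_norm_least) (simp add: pair_fun_def split: prod.splits)
  moreover have "(\<lambda>_. 0) \<in> dual_sp (+) (*\<^sub>R) (Yset k) (Ynorm N k)" for k
    by (rule y_functional_dual_sp[OF y_functional_zero[of 0]]) simp
  ultimately show ?thesis unfolding in_Lambda_def by auto
qed

lemma sigma_norm_set_nonempty: "{\<bar>lam g \<beta> u z\<bar> | g \<beta> u. Lam g \<beta> u} \<noteq> {}"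
  using in_Lambda_zero by blast

lemma sigma_norm_set_bdd: "bdd_above {\<bar>lam g \<beta> u z\<bar> | g \<beta> u. Lam g \<beta> u}"
proof (cases "z \<in> SS")
  case True
  obtain x y where z: "z = (x, y)" by fastforce
  show ?thesis using lam_fun_bound True z by (intro bdd_aboveI[where M="norm x + (1 + (\<Sum>k. (Yn k (y k))\<^sup>2)) / 2"]) auto
next
  case False
  then show ?thesis using lam_fun_out by (intro bdd_aboveI[where M=0]) auto
qed

lemma lam_fun_le_sigma_norm: "Lam g \<beta> u \<Longrightarrow> \<bar>lam g \<beta> u z\<bar> \<le> snorm z"
  unfolding sigma_norm_def by (rule cSup_upper[OF _ sigma_norm_set_bdd]) blast

lemma sigma_norm_least: "(\<And>g \<beta> u. Lam g \<beta> u \<Longrightarrow> \<bar>lam g \<beta> u z\<bar> \<le> M) \<Longrightarrow> snorm z \<le> M"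
  unfolding sigma_norm_def by (rule cSup_least[OF sigma_norm_set_nonempty]) blast

lemma sigma_norm_nonneg: "0 \<le> snorm z"
  using lam_fun_le_sigma_norm[OF in_Lambda_zero, of z] by (meson abs_ge_zero order_trans)

lemma SigmaSet_sadd: assumes "z \<in> SS" "w \<in> SS" shows "sadd z w \<in> SS"
proof -
  obtain x y where z: "z = (x, y)" by fastforce
  obtain x' y' where w: "w = (x', y')" by fastforce
  have yk: "y k \<in> Yset k" "y' k \<in> Yset k" for k using assms z w by (auto simp: SigmaSet_iff)
  have le: "(Yn k (y k + y' k))\<^sup>2 \<le> 2 * (Yn k (y k))\<^sup>2 + 2 * (Yn k (y' k))\<^sup>2" for k
  proof -
    have t: "Yn k (y k + y' k) \<le> Yn k (y k) + Yn k (y' k)"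
      using N_tri[OF yk(1) yk(2), of k 0 0] unfolding Ynorm_def by simp
    have "0 \<le> Yn k (y k + y' k)" using Ynorm_nonneg Y_add[OF yk(1) yk(2)] by auto
    then have "(Yn k (y k + y' k))\<^sup>2 \<le> (Yn k (y k) + Yn k (y' k))\<^sup>2" using t by (intro power_mono) auto
    also have "\<dots> \<le> 2 * (Yn k (y k))\<^sup>2 + 2 * (Yn k (y' k))\<^sup>2"
      using sum_squares_bound[of "Yn k (y k)" "Yn k (y' k)"] by (simp add: power2_eq_square algebra_simps)
    finally show ?thesis .
  qed
  have "summable (\<lambda>k. 2 * (Yn k (y k))\<^sup>2 + 2 * (Yn k (y' k))\<^sup>2)"
    using assms z w by (intro summable_add summable_mult) (auto simp: SigmaSet_iff)
  then have "summable (\<lambda>k. (Yn k (y k + y' k))\<^sup>2)"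
    by (rule summable_comparison_test[rotated]) (use le in auto)
  then show ?thesis using z w yk Y_add unfolding sadd_def by (auto simp: SigmaSet_iff)
qed

lemma Ynorm_scale: "y \<in> Yset k \<Longrightarrow> Yn k (c *\<^sub>R y) = \<bar>c\<bar> * Yn k y"
  using N_sc[of y k c 0] unfolding Ynorm_def by simp

lemma SigmaSet_sscale: assumes "z \<in> SS" shows "sscale c z \<in> SS"
proof -
  obtain x y where z: "z = (x, y)" by fastforce
  have yk: "y k \<in> Yset k" for k using assms z by (auto simp: SigmaSet_iff)
  have "summable (\<lambda>k. c\<^sup>2 * (Yn k (y k))\<^sup>2)" using assms z by (intro summable_mult) (auto simp: SigmaSet_iff)
  then have "summable (\<lambda>k. (Yn k (c *\<^sub>R y k))\<^sup>2)" using yk by (simp add: Ynorm_scale power_mult_distrib)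
  then show ?thesis using z yk Y_scale unfolding sscale_def by (auto simp: SigmaSet_iff)
qed

lemma lam_fun_sadd: assumes L: "Lam g \<beta> u" and "z \<in> SS" "w \<in> SS"
  shows "lam g \<beta> u (sadd z w) = lam g \<beta> u z + lam g \<beta> u w"
proof -
  note LamD = in_Lambda_D[OF L]
  obtain x y where z: "z = (x, y)" by fastforce
  obtain x' y' where w: "w = (x', y')" by fastforce
  have yk: "y k \<in> Yset k" "y' k \<in> Yset k" for k using assms z w by (auto simp: SigmaSet_iff)
  have s1: "summable (\<lambda>k. \<beta> k * u k (y k))" using weighted_series(1)[OF _ LamD(6) LamD(3)] assms z by auto
  have s2: "summable (\<lambda>k. \<beta> k * u k (y' k))" using weighted_series(1)[OF _ LamD(6) LamD(3)] assms w by auto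
  have "u k (y k + y' k) = u k (y k) + u k (y' k)" for k using LamD(3)[of k] yk unfolding y_functional_def by auto
  then have "(\<Sum>k. \<beta> k * u k (y k + y' k)) = (\<Sum>k. \<beta> k * u k (y k)) + (\<Sum>k. \<beta> k * u k (y' k))"
    using suminf_add[OF s1 s2] by (simp add: distrib_left)
  moreover have "g (x + x') = g x + g x'" using LamD(1) by (simp add: linear_add bounded_linear.linear)
  moreover have "sadd z w \<in> SS" using SigmaSet_sadd assms by auto
  ultimately show ?thesis using assms z w by (simp add: lam_fun_eq sadd_def)
qed

lemma lam_fun_sscale: assumes L: "Lam g \<beta> u" and "z \<in> SS"
  shows "lam g \<beta> u (sscale c z) = c * lam g \<beta> u z"
proof -
  note LamD = in_Lambda_D[OF L]
  obtain x y where z: "z = (x, y)" by fastforce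
  have yk: "y k \<in> Yset k" for k using assms z by (auto simp: SigmaSet_iff)
  have s1: "summable (\<lambda>k. \<beta> k * u k (y k))" using weighted_series(1)[OF _ LamD(6) LamD(3)] assms z by auto
  have "u k (c *\<^sub>R y k) = c * u k (y k)" for k using LamD(3)[of k] yk unfolding y_functional_def by auto
  then have "(\<Sum>k. \<beta> k * u k (c *\<^sub>R y k)) = c * (\<Sum>k. \<beta> k * u k (y k))"
    using suminf_mult[OF s1, of c] by (simp add: algebra_simps)
  moreover have "g (c *\<^sub>R x) = c * g x" using LamD(1) by (simp add: linear_scale bounded_linear.linear)
  moreover have "sscale c z \<in> SS" using SigmaSet_sscale assms by auto
  ultimately show ?thesis using assms z by (simp add: lam_fun_eq sscale_def algebra_simps)
qed

lemma sigma_norm_sscale_le: assumes "z \<in> SS" shows "snorm (sscale c z) \<le> \<bar>c\<bar> * snorm z"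
proof (rule sigma_norm_least)
  fix g \<beta> u assume L: "Lam g \<beta> u"
  show "\<bar>lam g \<beta> u (sscale c z)\<bar> \<le> \<bar>c\<bar> * snorm z"
    using lam_fun_sscale[OF L assms] lam_fun_le_sigma_norm[OF L, of z] by (simp add: abs_mult mult_left_mono)
qed

lemma sscale_inv: "c \<noteq> 0 \<Longrightarrow> sscale (1 / c) (sscale c z) = z"
  unfolding sscale_def by (cases z) auto

lemma sigma_norm_sscale: assumes "z \<in> SS" shows "snorm (sscale c z) = \<bar>c\<bar> * snorm z"
proof (cases "c = 0")
  case True
  then show ?thesis using sigma_norm_sscale_le[OF assms, of 0] sigma_norm_nonneg[of "sscale 0 z"] by simp
next
  case False
  have "snorm z = snorm (sscale (1 / c) (sscale c z))" by (simp only: sscale_inv[OF False])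
  also have "\<dots> \<le> \<bar>1 / c\<bar> * snorm (sscale c z)" by (rule sigma_norm_sscale_le[OF SigmaSet_sscale[OF assms]])
  finally have "\<bar>c\<bar> * snorm z \<le> snorm (sscale c z)" using False by (simp add: field_simps)
  with sigma_norm_sscale_le[OF assms, of c] show ?thesis by linarith
qed

sublocale Sig: normed_subset sadd sscale SS snorm
proof
  have "(0, \<lambda>_. 0) \<in> SS" using Y_zero by (auto simp: SigmaSet_iff Ynorm_def NX)
  then show "SS \<noteq> {}" by auto
qed (auto simp: SigmaSet_sadd SigmaSet_sscale sigma_norm_sscale sigma_norm_nonneg)

lemma y_functional_scale: "y_functional k u b \<Longrightarrow> y_functional k (\<lambda>y. c * u y) (\<bar>c\<bar> * b)"
  using y_functional_lin[of k u b u b c 0] by simp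

lemma in_Lambda_normalized:
  assumes G: "bounded_linear G" and m: "m > 0" and s: "s \<ge> 1"
    and \<gamma>0: "\<And>k. 0 \<le> \<gamma> k" and \<gamma>s: "summable (\<lambda>k. (\<gamma> k)\<^sup>2)" and \<gamma>le: "(\<Sum>k. (\<gamma> k)\<^sup>2) \<le> s\<^sup>2"
    and v: "\<And>k. y_functional k (v k) B"
    and dn: "\<And>k. DN k (P k G (\<lambda>y. s * v k y)) \<le> m"
  shows "Lam (\<lambda>x. (1/m) * G x) (\<lambda>k. \<gamma> k / s) (\<lambda>k y. (1/m) * (s * v k y))"
proof -
  have bl: "bounded_linear (\<lambda>x. (1/m) * G x)" by (rule bounded_linear_const_mult[OF G])
  have yf: "y_functional k (\<lambda>y. (1/m) * (s * v k y)) (\<bar>1/m\<bar> * (\<bar>s\<bar> * B))" for k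
    by (rule y_functional_scale[OF y_functional_scale[OF v]])
  have dn': "DN k (P k (\<lambda>x. (1/m) * G x) (\<lambda>y. (1/m) * (s * v k y))) \<le> 1" for k
  proof -
    have yf2: "y_functional k (\<lambda>y. s * v k y) (\<bar>s\<bar> * B)" by (rule y_functional_scale[OF v])
    have pb: "Z.bounded_functional k (P k G (\<lambda>y. s * v k y))" by (rule pair_fun_bounded[OF G yf2])
    have "DN k (P k (\<lambda>x. (1/m) * G x) (\<lambda>y. (1/m) * (s * v k y))) = DN k (\<lambda>w. (1/m) * P k G (\<lambda>y. s * v k y) w)"
      by (simp only: pair_fun_scale)
    also have "\<dots> = (1/m) * DN k (P k G (\<lambda>y. s * v k y))" using Z.dual_norm_scale[OF pb, of "1/m"] m by simp
    also have "\<dots> \<le> (1/m) * m" using dn[of k] m by (intro mult_left_mono) auto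
    finally show ?thesis using m by simp
  qed
  have gk: "\<gamma> k \<le> s" for k
  proof -
    have "(\<gamma> k)\<^sup>2 = (\<Sum>i\<in>{k}. (\<gamma> i)\<^sup>2)" by simp
    also have "\<dots> \<le> (\<Sum>i. (\<gamma> i)\<^sup>2)" by (rule sum_le_suminf[OF \<gamma>s]) auto
    also have "\<dots> \<le> s\<^sup>2" by (rule \<gamma>le)
    finally show ?thesis
      using s \<gamma>0[of k] by (meson abs_le_square_iff abs_of_nonneg order_trans zero_le_one power2_le_imp_le)
  qed
  have sq: "(\<lambda>k. (\<gamma> k / s)\<^sup>2) = (\<lambda>k. (\<gamma> k)\<^sup>2 / s\<^sup>2)" by (simp add: power_divide)
  have sm: "summable (\<lambda>k. (\<gamma> k / s)\<^sup>2)" unfolding sq by (rule summable_divide[OF \<gamma>s])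
  have "(\<Sum>k. (\<gamma> k / s)\<^sup>2) = (\<Sum>k. (\<gamma> k)\<^sup>2) / s\<^sup>2" unfolding sq by (rule suminf_divide[OF \<gamma>s])
  also have "\<dots> \<le> 1" using \<gamma>le s by simp
  finally have sl: "(\<Sum>k. (\<gamma> k / s)\<^sup>2) \<le> 1" .
  show ?thesis unfolding in_Lambda_def
    using bl yf[THEN y_functional_dual_sp] dn' \<gamma>0 gk s sm sl by (auto simp: field_simps)
qed

lemma lam_fun_normalized:
  assumes L: "Lam (\<lambda>x. (1/m) * G x) (\<lambda>k. \<gamma> k / s) (\<lambda>k y. (1/m) * (s * v k y))"
    and m: "m > 0" and s: "s \<ge> 1" and \<gamma>s: "summable (\<lambda>k. (\<gamma> k)\<^sup>2)" and v: "\<And>k. y_functional k (v k) B"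
    and w: "(x, y) \<in> SS"
  shows "summable (\<lambda>k. \<gamma> k * v k (y k))"
    and "lam (\<lambda>x. (1/m) * G x) (\<lambda>k. \<gamma> k / s) (\<lambda>k y. (1/m) * (s * v k y)) (x, y)
         = (1/m) * (G x + (\<Sum>k. \<gamma> k * v k (y k)))"
proof -
  show sm: "summable (\<lambda>k. \<gamma> k * v k (y k))" by (rule weighted_series(1)[OF w \<gamma>s v])
  have eq: "(\<lambda>k. \<gamma> k / s * ((1/m) * (s * v k (y k)))) = (\<lambda>k. (1/m) * (\<gamma> k * v k (y k)))"
    using s by (auto simp: field_simps)
  have "(\<Sum>k. \<gamma> k / s * ((1/m) * (s * v k (y k)))) = (1/m) * (\<Sum>k. \<gamma> k * v k (y k))"
    unfolding eq by (rule suminf_mult[OF sm])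
  then show "lam (\<lambda>x. (1/m) * G x) (\<lambda>k. \<gamma> k / s) (\<lambda>k y. (1/m) * (s * v k y)) (x, y)
         = (1/m) * (G x + (\<Sum>k. \<gamma> k * v k (y k)))"
    using w by (simp add: lam_fun_eq distrib_left)
qed

end

section \<open>Uniform smoothness at z* and the derivative of the dual norm\<close>

locale smooth_point = sigma_setting Yset N
  for Yset :: "nat \<Rightarrow> 'y::real_vector set" and N :: "nat \<Rightarrow> 'x::banach \<times> 'y \<Rightarrow> real" +
  fixes xs :: "'x \<Rightarrow> real" and \<alpha> :: "nat \<Rightarrow> real" and ys :: "nat \<Rightarrow> 'y \<Rightarrow> real"
  assumes smooth: "\<And>k. dual_frechet_smooth (+) (*\<^sub>R) (UNIV \<times> Yset k) (N k)"
    and zLam: "in_Lambda Yset N xs \<alpha> ys"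
    and zS: "dual_norm (SigmaSet Yset N) (sigma_norm Yset N) (lam_fun Yset N xs \<alpha> ys) = 1"
    and xsmall: "onorm xs < 1"
begin

abbreviation "a \<equiv> onorm xs"
abbreviation "\<phi> k \<equiv> P k xs (ys k)"
abbreviation "nn k \<equiv> DN k (\<phi> k)"

lemmas zLamD = in_Lambda_D[OF zLam]

lemma a_nonneg: "0 \<le> a" using onorm_pos_le[OF zLamD(1)] .
lemma a_less_1: "1 - a > 0" using xsmall by simp

lemma phi_dual: "\<phi> k \<in> ZD k" by (rule pair_fun_dual[OF zLamD(1) zLamD(3)])
lemma nn_le: "nn k \<le> 1" by (rule zLamD(8))
definition heavy :: "nat \<Rightarrow> bool" where "heavy k \<longleftrightarrow> \<alpha> k > 0 \<and> nn k > (1 + a) / 2"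

definition deriv :: "nat \<Rightarrow> ('x \<times> 'y \<Rightarrow> real) \<Rightarrow> real" where
  "deriv k = (SOME L. Z.supporting_derivative k (\<phi> k) L)"

lemma deriv_supporting: assumes "heavy k" shows "Z.supporting_derivative k (\<phi> k) (deriv k)"
proof -
  have "(1 + a) / 2 > 0" using a_nonneg by simp
  then have pos: "nn k > 0" using assms unfolding heavy_def by linarith
  have "\<exists>v\<in>Z k. \<phi> k v \<noteq> 0"
  proof (rule ccontr)
    assume "\<not> ?thesis"
    then have "nn k \<le> 0" by (intro Z.dual_norm_least) auto
    with pos show False by simp
  qed
  then have "frechet_diff_dual_norm (+) (*\<^sub>R) (Z k) (N k) (\<phi> k)"
    using smooth[of k] phi_dual unfolding dual_frechet_smooth_def by blast
  then obtain L where "Z.supporting_derivative k (\<phi> k) L"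
    by (rule Z.supporting_derivative_if_frechet_diff[OF phi_dual])
  then show ?thesis unfolding deriv_def by (metis someI)
qed

abbreviation "ly k \<equiv> deriv k (P k (\<lambda>_. 0) (ys k))"
abbreviation "lg k g \<equiv> deriv k (P k g (\<lambda>_. 0))"
abbreviation "lu k u \<equiv> deriv k (P k (\<lambda>_. 0) u)"

lemma ly_bounds: assumes "heavy k" shows "(1 - a) / 2 < ly k" "ly k \<le> 2"
proof -
  note gl = Z.supporting_derivativeD[OF deriv_supporting[OF assms]]
  have bl0: "bounded_linear (\<lambda>_::'x. 0::real)" by simp
  have d1: "P k xs (\<lambda>_. 0) \<in> ZD k" by (rule pair_fun_dual[OF zLamD(1) y_functional_zero[of 0]]) simp
  have d2: "P k (\<lambda>_. 0) (ys k) \<in> ZD k" by (rule pair_fun_dual[OF bl0 zLamD(3)])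
  have e1: "deriv k (\<phi> k) = deriv k (P k xs (\<lambda>_. 0)) + ly k"
    by (subst pair_fun_split) (rule gl(1)[OF d1 d2])
  have e2: "deriv k (P k xs (\<lambda>_. 0)) \<le> a"
    using gl(3)[OF d1] dual_norm_pair_fun_x[OF zLamD(1), of k] by linarith
  have e3: "nn k \<le> deriv k (\<phi> k)" by (rule gl(4))
  have e4: "nn k > (1 + a) / 2" using assms unfolding heavy_def by blast
  have e5: "nn k - a \<le> ly k" using e1 e2 e3 by linarith
  have e6: "(1 - a) / 2 = (1 + a) / 2 - a" by (simp add: field_simps)
  show "(1 - a) / 2 < ly k" unfolding e6 using e4 e5 by linarith
  show "ly k \<le> 2" using gl(3)[OF d2] dual_norm_pair_fun_y[OF zLamD(3), of k] by simp
qed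

lemma lg_bound: assumes "heavy k" "bounded_linear g" "onorm g \<le> 1" shows "\<bar>lg k g\<bar> \<le> 1"
proof -
  note gl = Z.supporting_derivativeD[OF deriv_supporting[OF assms(1)]]
  have d1: "P k g (\<lambda>_. 0) \<in> ZD k" by (rule pair_fun_dual[OF assms(2) y_functional_zero[of 0]]) simp
  show ?thesis using gl(3)[OF d1] dual_norm_pair_fun_x[OF assms(2), of k] assms(3) by linarith
qed

lemma lu_bound: assumes "heavy k" "y_functional k u 1" shows "\<bar>lu k u\<bar> \<le> 2"
proof -
  note gl = Z.supporting_derivativeD[OF deriv_supporting[OF assms(1)]]
  have bl0: "bounded_linear (\<lambda>_::'x. 0::real)" by simp
  have d2: "P k (\<lambda>_. 0) u \<in> ZD k" by (rule pair_fun_dual[OF bl0 assms(2)])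
  show ?thesis using gl(3)[OF d2] dual_norm_pair_fun_y[OF assms(2)] by simp
qed

lemma ys_y_functional: "y_functional k (ys k) 1" by (rule zLamD(3))
lemma bounded_linear_xs: "bounded_linear xs" by (rule zLamD(1))
lemma y_functional_weighted:
  assumes u: "y_functional k u 1" and \<gamma>: "\<gamma> \<ge> 0" and \<alpha>: "\<alpha>' \<ge> 0" and \<beta>: "\<beta> \<ge> 0"
    and \<sigma>: "\<bar>\<sigma>\<bar> = 1" and t: "t \<ge> 0"
  shows "y_functional k (\<lambda>y. (\<alpha>' * ys k y + \<sigma> * t * \<beta> * u y) / \<gamma>) ((\<alpha>' + t * \<beta>) / \<gamma>)"
proof -
  have "y_functional k (\<lambda>y. (\<alpha>' / \<gamma>) * ys k y + (\<sigma> * t * \<beta> / \<gamma>) * u y) (\<bar>\<alpha>' / \<gamma>\<bar> * 1 + \<bar>\<sigma> * t * \<beta> / \<gamma>\<bar> * 1)"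
    by (rule y_functional_lin[OF ys_y_functional u])
  moreover have "\<bar>\<alpha>' / \<gamma>\<bar> * 1 + \<bar>\<sigma> * t * \<beta> / \<gamma>\<bar> * 1 = (\<alpha>' + t * \<beta>) / \<gamma>"
    using \<gamma> \<alpha> \<beta> \<sigma> t by (simp add: abs_mult add_divide_distrib)
  moreover have "(\<lambda>y. (\<alpha>' / \<gamma>) * ys k y + (\<sigma> * t * \<beta> / \<gamma>) * u y) = (\<lambda>y. (\<alpha>' * ys k y + \<sigma> * t * \<beta> * u y) / \<gamma>)"
    by (auto simp: add_divide_distrib)
  ultimately show ?thesis by simp
qed

abbreviation "pert k g \<beta> u \<sigma> t \<gamma> \<equiv>
  P k (\<lambda>x. xs x + \<sigma> * t * g x) (\<lambda>y. (\<alpha> k * ys k y + \<sigma> * t * \<beta> * u y) / \<gamma>)"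

lemma dual_norm_pert_x_part:
  assumes g: "bounded_linear g" "onorm g \<le> 1" and \<sigma>: "\<bar>\<sigma>\<bar> = 1" and t: "t \<ge> 0"
  shows "DN k (P k (\<lambda>x. xs x + \<sigma> * t * g x) (\<lambda>_. 0)) \<le> a + t"
proof -
  have dg: "DN k (P k g (\<lambda>_. 0)) \<le> 1" using dual_norm_pair_fun_x[OF g(1), of k] g(2) by linarith
  have "P k (\<lambda>x. xs x + \<sigma> * t * g x) (\<lambda>_. 0) = (\<lambda>v. 1 * P k xs (\<lambda>_. 0) v + (\<sigma> * t) * P k g (\<lambda>_. 0) v)"
    by (auto simp: pair_fun_def)
  then have "DN k (P k (\<lambda>x. xs x + \<sigma> * t * g x) (\<lambda>_. 0))
      \<le> \<bar>1\<bar> * DN k (P k xs (\<lambda>_. 0)) + \<bar>\<sigma> * t\<bar> * DN k (P k g (\<lambda>_. 0))"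
    using Z.dual_norm_lincomb[OF pair_fun_x_bounded[OF bounded_linear_xs] pair_fun_x_bounded[OF g(1)], of k 1 "\<sigma> * t"]
    by simp
  also have "\<dots> \<le> a + t * 1"
    using dual_norm_pair_fun_x[OF bounded_linear_xs, of k] mult_left_mono[OF dg t] \<sigma> t by (simp add: abs_mult)
  finally show ?thesis by simp
qed

lemma tail_coordinate_decomposition:
  assumes \<rho>: "\<rho> \<noteq> 0" and c: "c \<noteq> 0" and \<gamma>: "\<gamma> = \<alpha> k / \<rho> + t * c * \<beta>" "\<gamma> \<noteq> 0"
  shows "(\<lambda>v. \<gamma> * pert k g \<beta> u \<sigma> t \<gamma> v) = (\<lambda>v.
      (\<alpha> k / \<rho>) * (\<rho> * \<phi> k v + (1 - \<rho>) * P k xs (\<lambda>_. 0) v)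
    + (t * c * \<beta>) * (P k xs (\<lambda>_. 0) v + (\<sigma> / c) * P k (\<lambda>_. 0) u v)
    + (\<sigma> * t * \<gamma>) * P k g (\<lambda>_. 0) v)"
proof
  fix v :: "'x \<times> 'y"
  obtain x y where v: "v = (x, y)" by fastforce
  show "\<gamma> * pert k g \<beta> u \<sigma> t \<gamma> v =
      (\<alpha> k / \<rho>) * (\<rho> * \<phi> k v + (1 - \<rho>) * P k xs (\<lambda>_. 0) v)
    + (t * c * \<beta>) * (P k xs (\<lambda>_. 0) v + (\<sigma> / c) * P k (\<lambda>_. 0) u v)
    + (\<sigma> * t * \<gamma>) * P k g (\<lambda>_. 0) v"
  proof (cases "y \<in> Yset k")
    case True
    have "\<gamma> * ((\<alpha> k * ys k y + \<sigma> * t * \<beta> * u y) / \<gamma>) = \<alpha> k * ys k y + \<sigma> * t * \<beta> * u y"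
      using \<gamma>(2) by simp
    then have "\<gamma> * pert k g \<beta> u \<sigma> t \<gamma> v = \<gamma> * xs x + \<sigma> * t * \<gamma> * g x + (\<alpha> k * ys k y + \<sigma> * t * \<beta> * u y)"
      using True v by (simp add: pair_fun_eq algebra_simps)
    also have "\<dots> = (\<alpha> k / \<rho>) * (\<rho> * (xs x + ys k y) + (1 - \<rho>) * xs x)
        + (t * c * \<beta>) * (xs x + (\<sigma> / c) * u y) + \<sigma> * t * \<gamma> * g x"
      using \<rho> c unfolding \<gamma>(1) by (simp add: field_simps)
    finally show ?thesis using True v by (simp add: pair_fun_eq)
  qed (use v in \<open>simp add: pair_fun_out\<close>)
qed

text \<open>Coordinates beyond the cut-off: after dividing by \<gamma>, the perturbed functional is a
  combination of the shrunk functional \<rho> \<phi>_k + (1 - \<rho>) x*, of x* plus a small multiple of u, and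
  of the g-part; the first two have norm at most 1 - t (1 + B), and the g-part costs t \<gamma>.\<close>
lemma dual_norm_tail_coordinate:
  assumes g: "bounded_linear g" "onorm g \<le> 1" and u: "y_functional k u 1" and \<beta>: "0 \<le> \<beta>"
    and \<sigma>: "\<bar>\<sigma>\<bar> = 1" and t: "t > 0" and \<alpha>: "0 \<le> \<alpha> k" and \<rho>: "\<rho> > 0" "\<rho> \<le> 1" and c: "c > 0"
    and \<gamma>: "\<gamma> = \<alpha> k / \<rho> + t * c * \<beta>"
    and h1: "\<rho> + (1 - \<rho>) * a \<le> 1 - t * (1 + B)" and h2: "a + 2 / c \<le> 1 - t * (1 + B)"
  shows "DN k (pert k g \<beta> u \<sigma> t \<gamma>) \<le> 1 - t * B"
proof (cases "\<gamma> = 0")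
  case True
  then have "pert k g \<beta> u \<sigma> t \<gamma> = P k (\<lambda>x. xs x + \<sigma> * t * g x) (\<lambda>_. 0)"
    by (auto simp: pair_fun_def)
  then have "DN k (pert k g \<beta> u \<sigma> t \<gamma>) \<le> a + t" using dual_norm_pert_x_part[OF g \<sigma>, of t k] t by simp
  moreover have "a + 2 / c \<le> 1 - t - t * B" and "0 < 2 / c" using h2 c by (simp_all add: algebra_simps)
  ultimately show ?thesis by linarith
next
  case False
  have "\<gamma> \<ge> 0" using \<gamma> \<alpha> \<rho> t c \<beta> by simp
  then have \<gamma>p: "\<gamma> > 0" using False by simp
  define A where "A = (\<lambda>v. \<rho> * \<phi> k v + (1 - \<rho>) * P k xs (\<lambda>_. 0) v)"
  define B' where "B' = (\<lambda>v. 1 * P k xs (\<lambda>_. 0) v + (\<sigma> / c) * P k (\<lambda>_. 0) u v)"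
  have bx: "Z.bounded_functional k (P k xs (\<lambda>_. 0))" by (rule pair_fun_x_bounded[OF bounded_linear_xs])
  have bg: "Z.bounded_functional k (P k g (\<lambda>_. 0))" by (rule pair_fun_x_bounded[OF g(1)])
  have bphi: "Z.bounded_functional k (\<phi> k)" by (rule Z.dual_sp_bounded_functional[OF phi_dual])
  have bA: "Z.bounded_functional k A" and bB: "Z.bounded_functional k B'" unfolding A_def B'_def
    by (intro Z.bounded_functional_add Z.bounded_functional_scale bphi bx pair_fun_y_bounded[OF u])+
  have dx: "DN k (P k xs (\<lambda>_. 0)) \<le> a" by (rule dual_norm_pair_fun_x[OF bounded_linear_xs])
  have dg: "DN k (P k g (\<lambda>_. 0)) \<le> 1" using dual_norm_pair_fun_x[OF g(1), of k] g(2) by linarith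
  have "DN k A \<le> \<bar>\<rho>\<bar> * nn k + \<bar>1 - \<rho>\<bar> * DN k (P k xs (\<lambda>_. 0))"
    unfolding A_def by (rule Z.dual_norm_lincomb[OF bphi bx])
  also have "\<dots> \<le> \<rho> * 1 + (1 - \<rho>) * a"
    using \<rho> dx nn_le[of k] by (simp add: add_mono mult_left_mono)
  finally have dA: "DN k A \<le> 1 - t * (1 + B)" using h1 by simp
  have "DN k B' \<le> a + (1 / c) * 2"
    using Z.dual_norm_lincomb[OF bx pair_fun_y_bounded[OF u], of 1 "\<sigma> / c"] dx
      mult_left_mono[OF dual_norm_pair_fun_y[OF u], of "1 / c"] \<sigma> c unfolding B'_def by simp
  then have dB: "DN k B' \<le> 1 - t * (1 + B)" using h2 by simp
  have decomp: "(\<lambda>v. \<gamma> * pert k g \<beta> u \<sigma> t \<gamma> v)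
      = (\<lambda>v. (\<alpha> k / \<rho>) * A v + (t * c * \<beta>) * B' v + (\<sigma> * t * \<gamma>) * P k g (\<lambda>_. 0) v)"
    using tail_coordinate_decomposition[OF _ _ \<gamma> False] \<rho> c unfolding A_def B'_def by simp
  have bF: "Z.bounded_functional k (pert k g \<beta> u \<sigma> t \<gamma>)"
    by (rule pair_fun_bounded[OF bounded_linear_add[OF bounded_linear_xs bounded_linear_const_mult[OF g(1)]]
          y_functional_weighted[OF u less_imp_le[OF \<gamma>p] \<alpha> \<beta> \<sigma> less_imp_le[OF t]]])
  have "\<gamma> * DN k (pert k g \<beta> u \<sigma> t \<gamma>) = DN k (\<lambda>v. \<gamma> * pert k g \<beta> u \<sigma> t \<gamma> v)"
    using Z.dual_norm_scale[OF bF, of \<gamma>] \<gamma>p by simp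
  also have "\<dots> \<le> DN k (\<lambda>v. (\<alpha> k / \<rho>) * A v + (t * c * \<beta>) * B' v)
      + DN k (\<lambda>v. (\<sigma> * t * \<gamma>) * P k g (\<lambda>_. 0) v)"
    unfolding decomp
    by (rule Z.dual_norm_triangle) (intro Z.bounded_functional_add Z.bounded_functional_scale bA bB bg)+
  also have "\<dots> \<le> (\<alpha> k / \<rho>) * DN k A + (t * c * \<beta>) * DN k B' + t * \<gamma> * DN k (P k g (\<lambda>_. 0))"
    using Z.dual_norm_lincomb[OF bA bB, of "\<alpha> k / \<rho>" "t * c * \<beta>"] Z.dual_norm_scale[OF bg, of "\<sigma> * t * \<gamma>"]
      \<alpha> \<rho> t c \<beta> \<sigma> \<gamma>p
    by (simp add: abs_mult)
  also have "\<dots> \<le> (\<alpha> k / \<rho>) * (1 - t * (1 + B)) + (t * c * \<beta>) * (1 - t * (1 + B)) + t * \<gamma> * 1"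
    using \<alpha> \<rho> t c \<beta> \<gamma>p
    by (intro add_mono mult_left_mono[OF dA] mult_left_mono[OF dB] mult_left_mono[OF dg]) auto
  also have "\<dots> = \<gamma> * (1 - t * B)" unfolding \<gamma> by (simp add: algebra_simps)
  finally show ?thesis using \<gamma>p by (simp add: mult_le_cancel_left_pos)
qed

lemma pert_eq_phi_plus:
  assumes \<gamma>: "\<gamma> = \<alpha> k + \<sigma> * t * \<eta>" "\<gamma> \<noteq> 0"
  shows "pert k g \<beta> u \<sigma> t \<gamma> = (\<lambda>v. \<phi> k v + (\<sigma> * t) * P k g (\<lambda>y. (\<beta> / \<gamma>) * u y + (- \<eta> / \<gamma>) * ys k y) v)"
proof
  fix v :: "'x \<times> 'y"
  obtain x y where v: "v = (x, y)" by fastforce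
  have "(\<alpha> k * ys k y + \<sigma> * t * \<beta> * u y) / \<gamma>
      = ((\<gamma> - \<sigma> * t * \<eta>) * ys k y + \<sigma> * t * \<beta> * u y) / \<gamma>" using \<gamma>(1) by simp
  also have "\<dots> = ys k y + \<sigma> * t * ((\<beta> / \<gamma>) * u y + (- \<eta> / \<gamma>) * ys k y)"
    using \<gamma>(2) by (simp add: field_simps)
  finally show "pert k g \<beta> u \<sigma> t \<gamma> v = \<phi> k v + (\<sigma> * t) * P k g (\<lambda>y. (\<beta> / \<gamma>) * u y + (- \<eta> / \<gamma>) * ys k y) v"
    using v by (cases "y \<in> Yset k") (simp_all add: pair_fun_eq pair_fun_out algebra_simps)
qed

lemma dual_norm_light_coordinate:
  assumes g: "bounded_linear g" "onorm g \<le> 1" and u: "y_functional k u 1" and \<beta>: "0 \<le> \<beta>" "\<beta> \<le> 1"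
    and \<sigma>: "\<bar>\<sigma>\<bar> = 1" and t: "t > 0" and \<alpha>: "0 < \<alpha> k" and light: "nn k \<le> (1 + a) / 2"
    and tc: "t * (1 + 2 / \<alpha> k) \<le> (1 - a) / 2 - t * B"
  shows "DN k (pert k g \<beta> u \<sigma> t (\<alpha> k)) \<le> 1 - t * B"
proof -
  let ?h = "P k g (\<lambda>y. (\<beta> / \<alpha> k) * u y + (- 0 / \<alpha> k) * ys k y)"
  have yw: "y_functional k (\<lambda>y. (\<beta> / \<alpha> k) * u y + (- 0 / \<alpha> k) * ys k y) (\<bar>\<beta> / \<alpha> k\<bar> * 1 + \<bar>- 0 / \<alpha> k\<bar> * 1)"
    by (rule y_functional_lin[OF u ys_y_functional])
  have "DN k ?h \<le> 1 + 2 * (\<beta> / \<alpha> k)"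
    using dual_norm_pair_fun_le[OF g(1) yw] g(2) \<beta> \<alpha> by simp
  also have "\<dots> \<le> 1 + 2 / \<alpha> k" using \<beta> \<alpha> by (simp add: divide_right_mono)
  finally have dh: "DN k ?h \<le> 1 + 2 / \<alpha> k" .
  have "DN k (pert k g \<beta> u \<sigma> t (\<alpha> k)) = DN k (\<lambda>v. 1 * \<phi> k v + (\<sigma> * t) * ?h v)"
    using pert_eq_phi_plus[of "\<alpha> k" k \<sigma> t 0] \<alpha> by simp
  also have "\<dots> \<le> \<bar>1\<bar> * nn k + \<bar>\<sigma> * t\<bar> * DN k ?h"
    by (rule Z.dual_norm_lincomb[OF Z.dual_sp_bounded_functional[OF phi_dual] pair_fun_bounded[OF g(1) yw]])
  also have "\<dots> = nn k + t * DN k ?h" using \<sigma> t by (simp add: abs_mult)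
  also have "\<dots> \<le> (1 + a) / 2 + t * (1 + 2 / \<alpha> k)"
    using light mult_left_mono[OF dh less_imp_le[OF t]] by linarith
  also have "\<dots> \<le> 1 - t * B" using tc by (simp add: field_simps)
  finally show ?thesis .
qed

lemma deriv_heavy_perturbation:
  assumes heavy: "heavy k" and g: "bounded_linear g" and u: "y_functional k u 1" and \<sigma>: "\<bar>\<sigma>\<bar> = 1"
    and \<gamma>: "\<gamma> = \<alpha> k + \<sigma> * t * \<eta>" "\<gamma> \<noteq> 0" and \<eta>: "\<eta> * ly k = \<alpha> k * (lg k g - D) + \<beta> * lu k u"
  shows "deriv k (\<lambda>v. (\<sigma> * t) * P k g (\<lambda>y. (\<beta> / \<gamma>) * u y + (- \<eta> / \<gamma>) * ys k y) v)
    = \<sigma> * t * D + t\<^sup>2 * ((lg k g - D) * \<eta> / \<gamma>)"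
proof -
  note gl = Z.supporting_derivativeD[OF deriv_supporting[OF heavy]]
  let ?w = "\<lambda>y. (\<beta> / \<gamma>) * u y + (- \<eta> / \<gamma>) * ys k y"
  have yw: "y_functional k ?w (\<bar>\<beta> / \<gamma>\<bar> * 1 + \<bar>- \<eta> / \<gamma>\<bar> * 1)" by (rule y_functional_lin[OF u ys_y_functional])
  have Zu: "P k (\<lambda>_. 0) u \<in> ZD k" and Zy: "P k (\<lambda>_. 0) (ys k) \<in> ZD k"
    by (rule pair_fun_y_dual[OF u], rule pair_fun_y_dual[OF ys_y_functional])
  have "P k (\<lambda>_. 0) ?w = (\<lambda>v. (\<beta> / \<gamma>) * P k (\<lambda>_. 0) u v + (- \<eta> / \<gamma>) * P k (\<lambda>_. 0) (ys k) v)"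
    by (auto simp: pair_fun_def)
  then have "deriv k (P k (\<lambda>_. 0) ?w)
      = deriv k (\<lambda>v. (\<beta> / \<gamma>) * P k (\<lambda>_. 0) u v + (- \<eta> / \<gamma>) * P k (\<lambda>_. 0) (ys k) v)"
    by (rule arg_cong[where f = "deriv k"])
  also have "\<dots> = deriv k (\<lambda>v. (\<beta> / \<gamma>) * P k (\<lambda>_. 0) u v) + deriv k (\<lambda>v. (- \<eta> / \<gamma>) * P k (\<lambda>_. 0) (ys k) v)"
    by (rule gl(1)[OF Z.dual_sp_scale[OF Zu] Z.dual_sp_scale[OF Zy]])
  also have "\<dots> = (\<beta> / \<gamma>) * lu k u + (- \<eta> / \<gamma>) * ly k"
    by (simp only: gl(2)[OF Zu] gl(2)[OF Zy])
  finally have "deriv k (P k (\<lambda>_. 0) ?w) = (\<beta> / \<gamma>) * lu k u + (- \<eta> / \<gamma>) * ly k" .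
  moreover have "deriv k (P k g ?w) = lg k g + deriv k (P k (\<lambda>_. 0) ?w)"
    by (subst pair_fun_split) (rule gl(1)[OF pair_fun_x_dual[OF g] pair_fun_y_dual[OF yw]])
  ultimately have "deriv k (P k g ?w) = lg k g + \<alpha> k * (D - lg k g) / \<gamma>"
    using \<eta> by (simp add: diff_divide_distrib add_divide_distrib algebra_simps)
  moreover have "deriv k (\<lambda>v. (\<sigma> * t) * P k g ?w v) = \<sigma> * t * deriv k (P k g ?w)"
    by (rule gl(2)[OF pair_fun_dual[OF g yw]])
  ultimately have "deriv k (\<lambda>v. (\<sigma> * t) * P k g ?w v) = \<sigma> * t * (lg k g + \<alpha> k * (D - lg k g) / \<gamma>)"
    by simp
  also have "\<dots> = \<sigma> * t * D + \<sigma> * t * (lg k g - D) * ((\<gamma> - \<alpha> k) / \<gamma>)"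
    using \<gamma>(2) by (simp add: field_simps)
  also have "\<dots> = \<sigma> * t * D + (\<sigma> * \<sigma>) * t\<^sup>2 * ((lg k g - D) * \<eta> / \<gamma>)"
    unfolding \<gamma>(1) by (simp add: power2_eq_square)
  also have "\<sigma> * \<sigma> = 1" using \<sigma> by (metis abs_mult_self_eq mult_1)
  finally show ?thesis by simp
qed

text \<open>Coordinates where \<phi>_k has large norm: here the Frechet smoothness of the dual of
  X \<oplus> Y_k is used, and the quadratic remainder comes from renormalising by \<gamma>.\<close>
lemma dual_norm_heavy_coordinate:
  assumes heavy: "heavy k" and g: "bounded_linear g" "onorm g \<le> 1" and u: "y_functional k u 1"
    and \<beta>: "0 \<le> \<beta>" "\<beta> \<le> 1" and \<sigma>: "\<bar>\<sigma>\<bar> = 1" and t: "t > 0"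
    and \<gamma>: "\<gamma> = \<alpha> k + \<sigma> * t * \<eta>" and \<gamma>pos: "\<gamma> \<ge> \<alpha> k / 2"
    and \<eta>: "\<eta> * ly k = \<alpha> k * (lg k g - D) + \<beta> * lu k u"
    and \<eta>b: "\<bar>\<eta>\<bar> \<le> B\<eta>" and Db: "\<bar>D\<bar> \<le> B"
    and fr: "\<forall>h\<in>ZD k. DN k h < \<delta> \<longrightarrow> DN k (\<lambda>v. \<phi> k v + h v) \<le> nn k + deriv k h + \<epsilon>' * DN k h"
    and \<epsilon>': "\<epsilon>' \<ge> 0" and t\<delta>: "t * (1 + 4 * (1 + B\<eta>) / \<alpha> k) < \<delta>"
  shows "DN k (pert k g \<beta> u \<sigma> t \<gamma>)
     \<le> 1 + \<sigma> * t * D + t\<^sup>2 * (2 * (1 + B) * B\<eta> / \<alpha> k) + \<epsilon>' * (t * (1 + 4 * (1 + B\<eta>) / \<alpha> k))"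
proof -
  have \<alpha>: "\<alpha> k > 0" using heavy unfolding heavy_def by simp
  have \<gamma>p: "\<gamma> > 0" using \<gamma>pos \<alpha> by simp
  let ?h = "P k g (\<lambda>y. (\<beta> / \<gamma>) * u y + (- \<eta> / \<gamma>) * ys k y)"
  have yw: "y_functional k (\<lambda>y. (\<beta> / \<gamma>) * u y + (- \<eta> / \<gamma>) * ys k y) ((\<beta> + \<bar>\<eta>\<bar>) / \<gamma>)"
    using y_functional_lin[OF u ys_y_functional, of "\<beta> / \<gamma>" "- \<eta> / \<gamma>"] \<beta> \<gamma>p by (simp add: add_divide_distrib)
  have "(\<beta> + \<bar>\<eta>\<bar>) / \<gamma> \<le> (1 + B\<eta>) / (\<alpha> k / 2)"
    using \<beta> \<eta>b \<gamma>pos \<alpha> by (intro frac_le) auto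
  then have "DN k ?h \<le> 1 + 2 * ((1 + B\<eta>) / (\<alpha> k / 2))"
    using dual_norm_pair_fun_le[OF g(1) yw] g(2) by linarith
  then have "DN k ?h \<le> 1 + 4 * (1 + B\<eta>) / \<alpha> k" by simp
  then have ht: "t * DN k ?h \<le> t * (1 + 4 * (1 + B\<eta>) / \<alpha> k)" using t by (intro mult_left_mono) auto
  have hb: "Z.bounded_functional k ?h" by (rule pair_fun_bounded[OF g(1) yw])
  have th: "DN k (\<lambda>v. (\<sigma> * t) * ?h v) = t * DN k ?h"
    using Z.dual_norm_scale[OF hb, of "\<sigma> * t"] \<sigma> t by (simp add: abs_mult)
  have "(\<lambda>v. (\<sigma> * t) * ?h v) \<in> ZD k" by (rule Z.dual_sp_scale[OF pair_fun_dual[OF g(1) yw]])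
  moreover have "DN k (\<lambda>v. (\<sigma> * t) * ?h v) < \<delta>" using th ht t\<delta> by linarith
  ultimately have "DN k (\<lambda>v. \<phi> k v + (\<sigma> * t) * ?h v) \<le> nn k + deriv k (\<lambda>v. (\<sigma> * t) * ?h v) + \<epsilon>' * (t * DN k ?h)"
    using fr th by fastforce
  moreover have "DN k (pert k g \<beta> u \<sigma> t \<gamma>) = DN k (\<lambda>v. \<phi> k v + (\<sigma> * t) * ?h v)"
    using pert_eq_phi_plus[OF \<gamma>] \<gamma>p by simp
  moreover have "deriv k (\<lambda>v. (\<sigma> * t) * ?h v) = \<sigma> * t * D + t\<^sup>2 * ((lg k g - D) * \<eta> / \<gamma>)"
    using deriv_heavy_perturbation[OF heavy g(1) u \<sigma> \<gamma>] \<gamma>p \<eta> by simp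
  moreover have "(lg k g - D) * \<eta> / \<gamma> \<le> 2 * (1 + B) * B\<eta> / \<alpha> k"
  proof -
    have "(lg k g - D) * \<eta> / \<gamma> \<le> \<bar>(lg k g - D) * \<eta> / \<gamma>\<bar>" by (rule abs_ge_self)
    also have "\<dots> = \<bar>lg k g - D\<bar> * \<bar>\<eta>\<bar> / \<gamma>" using \<gamma>p by (simp add: abs_mult)
    also have "\<dots> \<le> (1 + B) * B\<eta> / (\<alpha> k / 2)"
      using lg_bound[OF heavy g] Db \<eta>b \<gamma>pos \<alpha> by (intro frac_le mult_mono) auto
    also have "\<dots> = 2 * (1 + B) * B\<eta> / \<alpha> k" by simp
    finally show ?thesis .
  qed
  ultimately show ?thesis
    using mult_left_mono[of _ _ "t\<^sup>2"] mult_left_mono[OF ht \<epsilon>'] nn_le[of k] by fastforce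
qed

definition heavy_upto :: "nat \<Rightarrow> nat set" where "heavy_upto K = {k. k \<le> K \<and> heavy k}"
definition light_upto :: "nat \<Rightarrow> nat set" where "light_upto K = {k. k \<le> K \<and> \<alpha> k > 0 \<and> \<not> heavy k}"

lemma finite_heavy_upto: "finite (heavy_upto K)" unfolding heavy_upto_def by auto
lemma finite_light_upto: "finite (light_upto K)" unfolding light_upto_def by auto
lemma card_heavy_upto: "card (heavy_upto K) \<le> K + 1"
proof -
  have "heavy_upto K \<subseteq> {..K}" unfolding heavy_upto_def by auto
  then show ?thesis using card_mono[of "{..K}" "heavy_upto K"] by simp
qed

definition Num :: "nat \<Rightarrow> ('x \<Rightarrow> real) \<Rightarrow> (nat \<Rightarrow> real) \<Rightarrow> (nat \<Rightarrow> 'y \<Rightarrow> real) \<Rightarrow> real" where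
  "Num K g \<beta> u = (\<Sum>k\<in>heavy_upto K. \<alpha> k * (\<alpha> k * lg k g + \<beta> k * lu k (u k)) / ly k)"
definition Den :: "nat \<Rightarrow> real" where
  "Den K = (\<Sum>k\<in>heavy_upto K. (\<alpha> k)\<^sup>2 / ly k)"
text \<open>The common first order term D (Dv) is chosen so that \<Sum> \<alpha>_k \<eta>_k = 0 over the heavy
  coordinates (sum_eta); this cancels the term linear in t in \<Sum> \<gamma>_k^2 below.\<close>
definition Dv :: "nat \<Rightarrow> ('x \<Rightarrow> real) \<Rightarrow> (nat \<Rightarrow> real) \<Rightarrow> (nat \<Rightarrow> 'y \<Rightarrow> real) \<Rightarrow> real" where
  "Dv K g \<beta> u = Num K g \<beta> u / Den K"
definition eta :: "nat \<Rightarrow> ('x \<Rightarrow> real) \<Rightarrow> (nat \<Rightarrow> real) \<Rightarrow> (nat \<Rightarrow> 'y \<Rightarrow> real) \<Rightarrow> nat \<Rightarrow> real" where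
  "eta K g \<beta> u k = (\<alpha> k * (lg k g - Dv K g \<beta> u) + \<beta> k * lu k (u k)) / ly k"

lemma heavy_pos: "heavy k \<Longrightarrow> \<alpha> k > 0" unfolding heavy_def by simp
lemma ly_pos: "heavy k \<Longrightarrow> ly k > 0"
proof -
  assume b: "heavy k"
  have "(1 - a) / 2 > 0" using xsmall by simp
  then show "ly k > 0" using ly_bounds(1)[OF b] by (rule less_trans)
qed

lemma eta_eq: "heavy k \<Longrightarrow> eta K g \<beta> u k * ly k = \<alpha> k * (lg k g - Dv K g \<beta> u) + \<beta> k * lu k (u k)"
  unfolding eta_def using ly_pos[of k] by simp

lemma Den_pos: assumes "k0 \<in> heavy_upto K" shows "Den K \<ge> (\<alpha> k0)\<^sup>2 / 2"
proof -
  have nn: "\<forall>k\<in>heavy_upto K - {k0}. 0 \<le> (\<alpha> k)\<^sup>2 / ly k" using ly_pos unfolding heavy_upto_def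
    by (auto intro!: divide_nonneg_nonneg intro: less_imp_le)
  have "(\<alpha> k0)\<^sup>2 / 2 \<le> (\<alpha> k0)\<^sup>2 / ly k0"
    using ly_bounds(2)[of k0] ly_pos[of k0] assms unfolding heavy_upto_def by (intro divide_left_mono) auto
  also have "\<dots> \<le> Den K"
  proof -
    have "Den K = (\<alpha> k0)\<^sup>2 / ly k0 + (\<Sum>k\<in>heavy_upto K - {k0}. (\<alpha> k)\<^sup>2 / ly k)"
      unfolding Den_def using sum.remove[OF finite_heavy_upto assms] by simp
    moreover have "(\<Sum>k\<in>heavy_upto K - {k0}. (\<alpha> k)\<^sup>2 / ly k) \<ge> 0"
      using nn by (intro sum_nonneg) auto
    ultimately show ?thesis by simp
  qed
  finally show ?thesis .
qed

lemma sum_eta: "(\<Sum>k\<in>heavy_upto K. \<alpha> k * eta K g \<beta> u k) = 0"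
proof (cases "heavy_upto K = {}")
  case True then show ?thesis by simp
next
  case False
  then obtain k0 where k0: "k0 \<in> heavy_upto K" by auto
  have "\<alpha> k0 > 0" using heavy_pos[of k0] k0 unfolding heavy_upto_def by auto
  then have "(\<alpha> k0)\<^sup>2 / 2 > 0" by simp
  then have "Den K > 0" using Den_pos[OF k0] by (rule less_le_trans)
  have t: "\<alpha> k * eta K g \<beta> u k = \<alpha> k * (\<alpha> k * lg k g + \<beta> k * lu k (u k)) / ly k - Dv K g \<beta> u * ((\<alpha> k)\<^sup>2 / ly k)" for k
    unfolding eta_def by (simp add: divide_inverse algebra_simps power2_eq_square)
  have "(\<Sum>k\<in>heavy_upto K. \<alpha> k * eta K g \<beta> u k) = Num K g \<beta> u - Dv K g \<beta> u * Den K"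
    unfolding t Num_def Den_def by (simp add: sum_subtractf sum_distrib_left)
  also have "\<dots> = 0" using \<open>Den K > 0\<close> unfolding Dv_def by simp
  finally show ?thesis .
qed

lemma Num_term_bound:
  assumes k: "heavy k" and L: "Lam g \<beta> u"
  shows "\<bar>\<alpha> k * (\<alpha> k * lg k g + \<beta> k * lu k (u k)) / ly k\<bar> \<le> (2 / (1 - a)) * (2 * (\<alpha> k)\<^sup>2 + (\<beta> k)\<^sup>2)"
proof -
  note LamD = in_Lambda_D[OF L]
  have al: "\<alpha> k \<ge> 0" using heavy_pos[OF k] by simp
  have ly: "ly k > (1 - a) / 2" by (rule ly_bounds(1)[OF k])
  have "\<bar>\<alpha> k * lg k g + \<beta> k * lu k (u k)\<bar> \<le> \<alpha> k * 1 + \<beta> k * 2"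
    using lg_bound[OF k LamD(1) LamD(2)] lu_bound[OF k LamD(3)] al LamD(4)[of k]
    by (intro order_trans[OF abs_triangle_ineq] add_mono) (auto simp: abs_mult mult_left_le mult_left_mono)
  then have "\<bar>\<alpha> k * (\<alpha> k * lg k g + \<beta> k * lu k (u k))\<bar> \<le> \<alpha> k * (\<alpha> k * 1 + \<beta> k * 2)"
    unfolding abs_mult abs_of_nonneg[OF al] using al by (rule mult_left_mono)
  also have "\<dots> \<le> 2 * (\<alpha> k)\<^sup>2 + (\<beta> k)\<^sup>2"
    using sum_squares_bound[of "\<alpha> k" "\<beta> k"] by (simp add: power2_eq_square algebra_simps)
  finally have "\<bar>\<alpha> k * (\<alpha> k * lg k g + \<beta> k * lu k (u k))\<bar> / ly k \<le> (2 * (\<alpha> k)\<^sup>2 + (\<beta> k)\<^sup>2) / ((1 - a) / 2)"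
    using ly a_less_1 by (intro frac_le) auto
  then show ?thesis using ly a_less_1 by (simp add: abs_div field_simps)
qed

lemma Num_bound:
  assumes L: "Lam g \<beta> u" shows "\<bar>Num K g \<beta> u\<bar> \<le> 6 / (1 - a)"
proof -
  note LamD = in_Lambda_D[OF L]
  have "\<bar>Num K g \<beta> u\<bar> \<le> (\<Sum>k\<in>heavy_upto K. (2 / (1 - a)) * (2 * (\<alpha> k)\<^sup>2 + (\<beta> k)\<^sup>2))"
    unfolding Num_def using Num_term_bound[OF _ L] unfolding heavy_upto_def
    by (intro order_trans[OF sum_abs sum_mono]) auto
  also have "\<dots> = (2 / (1 - a)) * (2 * (\<Sum>k\<in>heavy_upto K. (\<alpha> k)\<^sup>2) + (\<Sum>k\<in>heavy_upto K. (\<beta> k)\<^sup>2))"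
    by (simp only: sum_distrib_left[symmetric] sum.distrib)
  also have "\<dots> \<le> (2 / (1 - a)) * (2 * 1 + 1)"
    using sum_le_suminf[OF zLamD(6) finite_heavy_upto, of K] zLamD(7)
      sum_le_suminf[OF LamD(6) finite_heavy_upto, of K] LamD(7) a_less_1
    by (intro mult_left_mono add_mono) auto
  finally show ?thesis by simp
qed

definition k0 :: nat where "k0 = (SOME k. heavy k)"
definition BD :: real where "BD = (if \<exists>k. heavy k then 12 / ((1 - a) * (\<alpha> k0)\<^sup>2) else 0)"

lemma BD_nonneg: "BD \<ge> 0"
  unfolding BD_def using xsmall by (auto intro!: divide_nonneg_nonneg mult_nonneg_nonneg)

lemma Dv_bound: assumes L: "Lam g \<beta> u" and K: "(\<exists>k. heavy k) \<longrightarrow> k0 \<le> K"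
  shows "\<bar>Dv K g \<beta> u\<bar> \<le> BD"
proof (cases "\<exists>k. heavy k")
  case False
  then have "heavy_upto K = {}" unfolding heavy_upto_def by auto
  then show ?thesis unfolding Dv_def Num_def BD_def using False by auto
next
  case True
  have bk0: "heavy k0" unfolding k0_def using True by (rule someI_ex)
  have k0H: "k0 \<in> heavy_upto K" using bk0 K True unfolding heavy_upto_def by auto
  have apos: "(\<alpha> k0)\<^sup>2 / 2 > 0" using heavy_pos[OF bk0] by simp
  have "Den K > 0" using Den_pos[OF k0H] apos by linarith
  then have "\<bar>Dv K g \<beta> u\<bar> = \<bar>Num K g \<beta> u\<bar> / Den K" unfolding Dv_def by (simp add: abs_div)
  also have "\<dots> \<le> (6 / (1 - a)) / ((\<alpha> k0)\<^sup>2 / 2)"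
    using Num_bound[OF L, of K] Den_pos[OF k0H] apos a_less_1 by (intro frac_le) auto
  also have "\<dots> = BD" unfolding BD_def using True by (simp add: field_simps)
  finally show ?thesis .
qed

definition Beta :: real where "Beta = 2 * (3 + BD) / (1 - a)"

lemma eta_bound: assumes L: "Lam g \<beta> u" and K: "(\<exists>k. heavy k) \<longrightarrow> k0 \<le> K" and k: "k \<in> heavy_upto K"
  shows "\<bar>eta K g \<beta> u k\<bar> \<le> Beta"
proof -
  note LamD = in_Lambda_D[OF L]
  have bk: "heavy k" using k unfolding heavy_upto_def by auto
  have lg: "\<bar>lg k g\<bar> \<le> 1" by (rule lg_bound[OF bk LamD(1) LamD(2)])
  have lu: "\<bar>lu k (u k)\<bar> \<le> 2" by (rule lu_bound[OF bk LamD(3)])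
  have ly: "ly k > (1 - a) / 2" by (rule ly_bounds(1)[OF bk])
  have D: "\<bar>Dv K g \<beta> u\<bar> \<le> BD" by (rule Dv_bound[OF L K])
  have al: "0 \<le> \<alpha> k" "\<alpha> k \<le> 1" using zLamD(4,5) by auto
  have "\<bar>\<alpha> k * (lg k g - Dv K g \<beta> u) + \<beta> k * lu k (u k)\<bar> \<le> 1 * (1 + BD) + 1 * 2"
  proof -
    have "\<bar>\<alpha> k * (lg k g - Dv K g \<beta> u)\<bar> \<le> 1 * (1 + BD)"
      unfolding abs_mult using al lg D by (intro mult_mono) auto
    moreover have "\<bar>\<beta> k * lu k (u k)\<bar> \<le> 1 * 2"
      unfolding abs_mult using LamD(4,5)[of k] lu by (intro mult_mono) auto
    ultimately show ?thesis by (rule order_trans[OF abs_triangle_ineq add_mono])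
  qed
  then have n: "\<bar>\<alpha> k * (lg k g - Dv K g \<beta> u) + \<beta> k * lu k (u k)\<bar> \<le> 3 + BD" by simp
  have "\<bar>eta K g \<beta> u k\<bar> = \<bar>\<alpha> k * (lg k g - Dv K g \<beta> u) + \<beta> k * lu k (u k)\<bar> / ly k"
    unfolding eta_def using ly a_less_1 by (simp add: abs_div)
  also have "\<dots> \<le> (3 + BD) / ((1 - a) / 2)" using n ly a_less_1 by (intro frac_le) auto
  also have "\<dots> = Beta" unfolding Beta_def using a_less_1 by (simp add: field_simps)
  finally show ?thesis .
qed

definition c0 :: real where "c0 = 4 / (1 - a)"
definition rho :: "real \<Rightarrow> real" where "rho t = 1 - t * (1 + BD) / (1 - a)"
text \<open>Weights of the renormalised functional z* + \<sigma> t g*: heavy coordinates move by \<sigma> t \<eta>_k,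
  light ones keep \<alpha>_k, and the remaining ones are inflated by 1/\<rho> so that the shrunk
  functional \<rho> \<phi>_k + (1 - \<rho>) x* absorbs the perturbation.\<close>
definition gam :: "nat \<Rightarrow> ('x \<Rightarrow> real) \<Rightarrow> (nat \<Rightarrow> real) \<Rightarrow> (nat \<Rightarrow> 'y \<Rightarrow> real) \<Rightarrow> real \<Rightarrow> real \<Rightarrow> nat \<Rightarrow> real"
  where
  "gam K g \<beta> u t \<sigma> k = (if k \<in> heavy_upto K then \<alpha> k + \<sigma> * t * eta K g \<beta> u k
      else if k \<in> light_upto K then \<alpha> k else \<alpha> k / rho t + t * c0 * \<beta> k)"
definition vv :: "nat \<Rightarrow> ('x \<Rightarrow> real) \<Rightarrow> (nat \<Rightarrow> real) \<Rightarrow> (nat \<Rightarrow> 'y \<Rightarrow> real) \<Rightarrow> real \<Rightarrow> real \<Rightarrow> nat \<Rightarrow> 'y \<Rightarrow> real"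
  where
  "vv K g \<beta> u t \<sigma> k = (\<lambda>y. (\<alpha> k * ys k y + \<sigma> * t * \<beta> k * u k y) / gam K g \<beta> u t \<sigma> k)"
definition am :: "nat \<Rightarrow> real" where "am K = Min (insert 1 (\<alpha> ` (heavy_upto K \<union> light_upto K)))"
definition EE :: "nat \<Rightarrow> real" where "EE K = 2 * (1 + BD) * Beta / am K"
definition BH :: "nat \<Rightarrow> real" where "BH K = 1 + 4 * (1 + Beta) / am K"

lemma am_pos: "am K > 0"
proof -
  have "finite (insert 1 (\<alpha> ` (heavy_upto K \<union> light_upto K)))" using finite_heavy_upto finite_light_upto by simp
  moreover have "\<forall>x\<in>insert 1 (\<alpha> ` (heavy_upto K \<union> light_upto K)). x > 0"
    using heavy_pos unfolding heavy_upto_def light_upto_def by auto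
  ultimately show ?thesis unfolding am_def by (subst Min_gr_iff) auto
qed

lemma am_le: "k \<in> heavy_upto K \<union> light_upto K \<Longrightarrow> am K \<le> \<alpha> k"
  unfolding am_def using finite_heavy_upto finite_light_upto by (intro Min_le) auto

lemma Beta_ge: "Beta \<ge> 6"
proof -
  have "6 * (1 - a) \<le> 2 * (3 + BD)" using BD_nonneg a_nonneg by simp
  then show ?thesis unfolding Beta_def using a_less_1 by (simp add: field_simps)
qed

lemma c0_ge: "c0 \<ge> 4" unfolding c0_def using a_less_1 a_nonneg by (simp add: field_simps)

lemma alpha_zero_off_heavy_light: "k \<notin> heavy_upto K \<Longrightarrow> k \<notin> light_upto K \<Longrightarrow> k \<le> K \<Longrightarrow> \<alpha> k = 0"
  unfolding heavy_upto_def light_upto_def using zLamD(4)[of k] by (cases "heavy k") (auto simp: heavy_def)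

lemma rho_props: assumes T1: "t * (1 + BD) \<le> (1 - a) / 2" and t: "t > 0"
  shows "rho t \<ge> 1/2" "rho t \<le> 1" "rho t + (1 - rho t) * a = 1 - t * (1 + BD)"
proof -
  have "t * (1 + BD) / (1 - a) \<le> 1/2" using T1 a_less_1 by (simp add: divide_le_eq)
  then show "rho t \<ge> 1/2" unfolding rho_def by simp
  show "rho t \<le> 1" unfolding rho_def using t BD_nonneg a_less_1 by simp
  have e1: "rho t + (1 - rho t) * a = 1 - (1 - rho t) * (1 - a)" by (simp add: algebra_simps)
  have e2: "(1 - rho t) * (1 - a) = t * (1 + BD)" unfolding rho_def using a_less_1 by simp
  show "rho t + (1 - rho t) * a = 1 - t * (1 + BD)" using e1 e2 by simp
qed

definition WW :: "nat \<Rightarrow> real \<Rightarrow> real \<Rightarrow> real" where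
  "WW K t \<mu> = t * (real K + 1) * Beta\<^sup>2 + 8 * \<mu>\<^sup>2 * (1 + BD) / (1 - a) + 4 * c0 * \<mu> + t * c0\<^sup>2"

lemma WW_nonneg: "t \<ge> 0 \<Longrightarrow> \<mu> \<ge> 0 \<Longrightarrow> WW K t \<mu> \<ge> 0"
  unfolding WW_def using BD_nonneg a_less_1 c0_ge by (intro add_nonneg_nonneg mult_nonneg_nonneg divide_nonneg_nonneg) auto

lemma rho_inverse_bounds: assumes T1: "t * (1 + BD) \<le> (1 - a) / 2" and t: "t > 0"
  shows "1 / (rho t)\<^sup>2 - 1 \<le> 8 * t * (1 + BD) / (1 - a)" "1 / rho t \<le> 2"
proof -
  have r: "rho t \<ge> 1/2" "rho t \<le> 1" using rho_props[OF T1 t] by auto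
  have r1: "1 - rho t = t * (1 + BD) / (1 - a)" unfolding rho_def by simp
  have "1 / (rho t)\<^sup>2 - 1 = (1 - rho t) * (1 + rho t) / (rho t)\<^sup>2"
    using r by (simp add: field_simps power2_eq_square)
  also have "\<dots> \<le> (1 - rho t) * 2 / (1/4)"
  proof (rule frac_le)
    show "0 \<le> (1 - rho t) * 2" using r by simp
    show "(1 - rho t) * (1 + rho t) \<le> (1 - rho t) * 2" using r by (intro mult_left_mono) auto
    show "0 < (1::real) / 4" by simp
    have "(1/2)\<^sup>2 \<le> (rho t)\<^sup>2" using r by (intro power_mono) auto
    then show "1 / 4 \<le> (rho t)\<^sup>2" by (simp add: power2_eq_square)
  qed
  also have "\<dots> = 8 * t * (1 + BD) / (1 - a)" unfolding r1 by simp
  finally show "1 / (rho t)\<^sup>2 - 1 \<le> 8 * t * (1 + BD) / (1 - a)" .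
  show "1 / rho t \<le> 2" using r by (simp add: divide_le_eq)
qed

context
  fixes K :: nat and g :: "'x \<Rightarrow> real" and \<beta> :: "nat \<Rightarrow> real" and u :: "nat \<Rightarrow> 'y \<Rightarrow> real"
    and t \<sigma> \<delta> \<epsilon>' \<mu> :: real
  assumes L: "Lam g \<beta> u" and K0: "(\<exists>k. heavy k) \<longrightarrow> k0 \<le> K" and \<sigma>: "\<bar>\<sigma>\<bar> = 1" and t: "t > 0"
    and T1: "t * (1 + BD) \<le> (1 - a) / 2"
    and T2: "t * Beta \<le> am K / 2"
    and T3: "t * (1 + 2 / am K) \<le> (1 - a) / 2 - t * BD"
    and T4: "t * BH K < \<delta>"
    and fr: "\<forall>k\<in>heavy_upto K. \<forall>h\<in>ZD k. DN k h < \<delta> \<longrightarrow> DN k (\<lambda>v. \<phi> k v + h v) \<le> nn k + deriv k h + \<epsilon>' * DN k h"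
    and \<epsilon>': "\<epsilon>' \<ge> 0"
    and \<mu>: "\<mu> > 0" "\<mu> \<le> 1"
    and tail: "(\<Sum>k. if K < k then (\<alpha> k)\<^sup>2 else 0) \<le> \<mu>\<^sup>2"
begin

lemmas LamD = in_Lambda_D[OF L]

abbreviation "\<gamma> \<equiv> gam K g \<beta> u t \<sigma>"

lemma gam_heavy_ge: assumes k: "k \<in> heavy_upto K" shows "gam K g \<beta> u t \<sigma> k \<ge> \<alpha> k / 2"
proof -
  have e: "\<bar>eta K g \<beta> u k\<bar> \<le> Beta" by (rule eta_bound[OF L K0 k])
  have "\<bar>\<sigma> * t * eta K g \<beta> u k\<bar> \<le> t * Beta" using e \<sigma> t by (simp add: abs_mult mult_left_mono)
  moreover have "am K \<le> \<alpha> k" using am_le k by auto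
  ultimately have "\<sigma> * t * eta K g \<beta> u k \<ge> - (\<alpha> k / 2)"
    using T2 abs_le_D2[of "\<sigma> * t * eta K g \<beta> u k" "t * Beta"] by linarith
  then show ?thesis unfolding gam_def using k by simp
qed

lemma gam_nonneg: "gam K g \<beta> u t \<sigma> k \<ge> 0"
proof -
  have r: "rho t > 0" using rho_props(1)[OF T1 t] by simp
  show ?thesis
  proof (cases "k \<in> heavy_upto K")
    case True
    then show ?thesis using gam_heavy_ge[OF True] heavy_pos[of k] unfolding heavy_upto_def by fastforce
  next
    case False
    then show ?thesis unfolding gam_def using zLamD(4)[of k] LamD(4)[of k] r t c0_ge by auto
  qed
qed

lemma vv_weight_le: "(\<alpha> k + t * \<beta> k) / gam K g \<beta> u t \<sigma> k \<le> 4"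
proof -
  let ?\<gamma> = "gam K g \<beta> u t \<sigma> k"
  show ?thesis
  proof (cases "k \<in> heavy_upto K")
    case True
    have g2: "?\<gamma> \<ge> \<alpha> k / 2" by (rule gam_heavy_ge[OF True])
    have ap: "\<alpha> k > 0" using True heavy_pos unfolding heavy_upto_def by auto
    have "t * 6 \<le> t * Beta" using Beta_ge t by simp
    moreover have "am K \<le> \<alpha> k" using am_le[of k K] True by auto
    ultimately have "t \<le> \<alpha> k" using T2 ap by linarith
    moreover have "t * \<beta> k \<le> t" using LamD(5)[of k] t by (simp add: mult_left_le)
    ultimately have "\<alpha> k + t * \<beta> k \<le> 2 * \<alpha> k" by linarith
    then show ?thesis using g2 ap by (simp add: divide_le_eq)
  next
    case F1: False
    show ?thesis
    proof (cases "k \<in> light_upto K")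
      case True
      have ap: "\<alpha> k > 0" using True unfolding light_upto_def by auto
      have "?\<gamma> = \<alpha> k" unfolding gam_def using F1 True by simp
      moreover have "t * Beta \<le> \<alpha> k" using T2 am_le[of k K] True am_pos[of K] by simp
      moreover have "t \<le> t * Beta" using Beta_ge t by simp
      moreover have "t * \<beta> k \<le> t" using LamD(5)[of k] t by simp
      ultimately have "\<alpha> k + t * \<beta> k \<le> 2 * ?\<gamma>" by linarith
      then show ?thesis using ap \<open>?\<gamma> = \<alpha> k\<close> by (simp add: divide_le_eq)
    next
      case False
      have r: "rho t > 0" "rho t \<le> 1" using rho_props(1,2)[OF T1 t] by auto
      have g: "?\<gamma> = \<alpha> k / rho t + t * c0 * \<beta> k" unfolding gam_def using F1 False by simp
      have "\<alpha> k \<le> \<alpha> k / rho t" using r zLamD(4)[of k] by (simp add: le_divide_eq mult_left_le)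
      moreover have "t * \<beta> k \<le> t * c0 * \<beta> k" using c0_ge t LamD(4)[of k] by (simp add: mult_right_mono)
      ultimately have le: "\<alpha> k + t * \<beta> k \<le> ?\<gamma>" unfolding g by linarith
      show ?thesis
      proof (cases "?\<gamma> = 0")
        case True then show ?thesis by simp
      next
        case False
        then have "?\<gamma> > 0" using gam_nonneg by (simp add: order_le_neq_trans)
        then have "(\<alpha> k + t * \<beta> k) / ?\<gamma> \<le> 1" using le by simp
        then show ?thesis by simp
      qed
    qed
  qed
qed

lemma y_functional_vv: "y_functional k (vv K g \<beta> u t \<sigma> k) 4"
  using y_functional_weighted[OF LamD(3) gam_nonneg zLamD(4) LamD(4) \<sigma> less_imp_le[OF t]] vv_weight_le
  unfolding vv_def by (rule y_functional_mono)

lemma dual_norm_coordinate_heavy: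
  assumes k: "k \<in> heavy_upto K"
  shows "DN k (pert k g (\<beta> k) (u k) \<sigma> t (gam K g \<beta> u t \<sigma> k))
    \<le> 1 + \<sigma> * t * Dv K g \<beta> u + t\<^sup>2 * EE K + \<epsilon>' * (t * BH K)"
proof -
  have heavy: "heavy k" using k unfolding heavy_upto_def by auto
  have ak: "am K \<le> \<alpha> k" "\<alpha> k > 0" using am_le[of k K] k heavy_pos[OF heavy] by auto
  have BHk: "t * (1 + 4 * (1 + Beta) / \<alpha> k) \<le> t * BH K"
    unfolding BH_def using ak am_pos[of K] Beta_ge t by (intro mult_left_mono add_left_mono divide_left_mono) auto
  have Ek: "2 * (1 + BD) * Beta / \<alpha> k \<le> EE K"
    unfolding EE_def using ak am_pos[of K] Beta_ge BD_nonneg by (intro divide_left_mono) auto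
  have "DN k (pert k g (\<beta> k) (u k) \<sigma> t (gam K g \<beta> u t \<sigma> k))
     \<le> 1 + \<sigma> * t * Dv K g \<beta> u + t\<^sup>2 * (2 * (1 + BD) * Beta / \<alpha> k) + \<epsilon>' * (t * (1 + 4 * (1 + Beta) / \<alpha> k))"
  proof (rule dual_norm_heavy_coordinate[OF heavy LamD(1) LamD(2) LamD(3) LamD(4) LamD(5) \<sigma> t])
    show "gam K g \<beta> u t \<sigma> k = \<alpha> k + \<sigma> * t * eta K g \<beta> u k" unfolding gam_def using k by simp
    show "gam K g \<beta> u t \<sigma> k \<ge> \<alpha> k / 2" by (rule gam_heavy_ge[OF k])
    show "eta K g \<beta> u k * ly k = \<alpha> k * (lg k g - Dv K g \<beta> u) + \<beta> k * lu k (u k)" by (rule eta_eq[OF heavy])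
    show "\<bar>eta K g \<beta> u k\<bar> \<le> Beta" by (rule eta_bound[OF L K0 k])
    show "\<bar>Dv K g \<beta> u\<bar> \<le> BD" by (rule Dv_bound[OF L K0])
    show "\<forall>h\<in>ZD k. DN k h < \<delta> \<longrightarrow> DN k (\<lambda>v. \<phi> k v + h v) \<le> nn k + deriv k h + \<epsilon>' * DN k h"
      using fr k by blast
    show "t * (1 + 4 * (1 + Beta) / \<alpha> k) < \<delta>" using BHk T4 by linarith
  qed (rule \<epsilon>')
  moreover have "t\<^sup>2 * (2 * (1 + BD) * Beta / \<alpha> k) \<le> t\<^sup>2 * EE K" using Ek by (intro mult_left_mono) auto
  moreover have "\<epsilon>' * (t * (1 + 4 * (1 + Beta) / \<alpha> k)) \<le> \<epsilon>' * (t * BH K)" using BHk \<epsilon>' by (rule mult_left_mono)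
  ultimately show ?thesis by linarith
qed

lemma dual_norm_coordinate_light:
  assumes k: "k \<in> light_upto K"
  shows "DN k (pert k g (\<beta> k) (u k) \<sigma> t (gam K g \<beta> u t \<sigma> k)) \<le> 1 - t * BD"
proof -
  have ak: "am K \<le> \<alpha> k" "\<alpha> k > 0" "\<not> heavy k" using am_le[of k K] k unfolding light_upto_def by auto
  have "k \<notin> heavy_upto K" using ak(3) unfolding heavy_upto_def by auto
  then have g: "gam K g \<beta> u t \<sigma> k = \<alpha> k" unfolding gam_def using k by simp
  have "2 / \<alpha> k \<le> 2 / am K" using ak am_pos[of K] by (intro divide_left_mono) auto
  then have "t * (1 + 2 / \<alpha> k) \<le> t * (1 + 2 / am K)" using t by (intro mult_left_mono) auto
  then have tc: "t * (1 + 2 / \<alpha> k) \<le> (1 - a) / 2 - t * BD" using T3 by linarith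
  have "nn k \<le> (1 + a) / 2" using ak(2,3) unfolding heavy_def by auto
  from dual_norm_light_coordinate[OF LamD(1) LamD(2) LamD(3)[of k] LamD(4)[of k] LamD(5)[of k] \<sigma> t ak(2) this tc]
  show ?thesis unfolding g .
qed

lemma dual_norm_coordinate_tail:
  assumes "k \<notin> heavy_upto K" "k \<notin> light_upto K"
  shows "DN k (pert k g (\<beta> k) (u k) \<sigma> t (gam K g \<beta> u t \<sigma> k)) \<le> 1 - t * BD"
proof -
  have r: "rho t > 0" "rho t \<le> 1" "rho t + (1 - rho t) * a = 1 - t * (1 + BD)" using rho_props[OF T1 t] by auto
  have g: "gam K g \<beta> u t \<sigma> k = \<alpha> k / rho t + t * c0 * \<beta> k" unfolding gam_def using assms by simp
  have "2 / c0 = (1 - a) / 2" unfolding c0_def using a_less_1 by simp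
  then have h2: "a + 2 / c0 \<le> 1 - t * (1 + BD)" using T1 by simp
  show ?thesis using dual_norm_tail_coordinate[OF LamD(1) LamD(2) LamD(3)[of k] LamD(4)[of k] \<sigma> t zLamD(4)[of k]
      r(1) r(2) _ g _ h2] c0_ge r(3) by simp
qed

lemma dual_norm_coordinate:
  "DN k (P k (\<lambda>x. xs x + \<sigma> * t * g x) (vv K g \<beta> u t \<sigma> k))
     \<le> 1 + \<sigma> * t * Dv K g \<beta> u + t\<^sup>2 * EE K + \<epsilon>' * (t * BH K)"
proof -
  have "\<bar>\<sigma> * t * Dv K g \<beta> u\<bar> \<le> t * BD" using Dv_bound[OF L K0] \<sigma> t by (simp add: abs_mult mult_left_mono)
  then have "1 - t * BD \<le> 1 + \<sigma> * t * Dv K g \<beta> u" by (simp add: abs_le_iff)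
  moreover have "0 \<le> t\<^sup>2 * EE K + \<epsilon>' * (t * BH K)"
    unfolding EE_def BH_def using BD_nonneg Beta_ge am_pos[of K] t \<epsilon>'
    by (intro add_nonneg_nonneg mult_nonneg_nonneg) auto
  ultimately show ?thesis
    using dual_norm_coordinate_heavy dual_norm_coordinate_light dual_norm_coordinate_tail
    unfolding vv_def by fastforce
qed

definition RR_heavy :: "nat \<Rightarrow> real" where
  "RR_heavy k = (if k \<in> heavy_upto K then 2 * \<sigma> * t * \<alpha> k * eta K g \<beta> u k + t\<^sup>2 * Beta\<^sup>2 else 0)"

definition RR_tail :: "nat \<Rightarrow> real" where
  "RR_tail k = (if K < k then (\<alpha> k)\<^sup>2 * (1 / (rho t)\<^sup>2 - 1) + 2 * t * c0 * \<alpha> k * \<beta> k / rho t else 0)"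

definition RR :: "nat \<Rightarrow> real" where
  "RR k = RR_heavy k + RR_tail k + t\<^sup>2 * c0\<^sup>2 * (\<beta> k)\<^sup>2"

lemma summable_RR_heavy: "summable RR_heavy"
  unfolding RR_heavy_def by (rule summable_finite[OF finite_heavy_upto]) auto

lemma sum_RR_heavy_le: "(\<Sum>k. RR_heavy k) \<le> t\<^sup>2 * Beta\<^sup>2 * (real K + 1)"
proof -
  have "(\<Sum>k. RR_heavy k) = (\<Sum>k\<in>heavy_upto K. RR_heavy k)"
    by (rule suminf_finite[OF finite_heavy_upto]) (auto simp: RR_heavy_def)
  also have "\<dots> = 2 * \<sigma> * t * (\<Sum>k\<in>heavy_upto K. \<alpha> k * eta K g \<beta> u k) + t\<^sup>2 * Beta\<^sup>2 * card (heavy_upto K)"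
    unfolding RR_heavy_def by (simp add: sum.distrib sum_distrib_left mult.assoc)
  also have "\<dots> = t\<^sup>2 * Beta\<^sup>2 * card (heavy_upto K)" using sum_eta by simp
  also have "\<dots> \<le> t\<^sup>2 * Beta\<^sup>2 * (real K + 1)" using card_heavy_upto[of K] by (intro mult_left_mono) auto
  finally show ?thesis .
qed

lemma RR_tail_summable_le:
  shows "summable RR_tail" and "(\<Sum>k. RR_tail k) \<le> 8 * t * (1 + BD) / (1 - a) * \<mu>\<^sup>2 + 4 * t * c0 * \<mu>"
proof -
  define T where "T k = (if K < k then (\<alpha> k)\<^sup>2 else 0)" for k
  define q where "q = 8 * t * (1 + BD) / (1 - a)"
  define c where "c = t * c0 / rho t"
  have r: "rho t > 0" "1 / rho t \<le> 2" "1 / (rho t)\<^sup>2 - 1 \<le> q"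
    using rho_props(1)[OF T1 t] rho_inverse_bounds[OF T1 t] unfolding q_def by auto
  have c: "0 \<le> c" "c \<le> 2 * t * c0" using t c0_ge r unfolding c_def by (auto simp: divide_le_eq)
  have sT: "summable T" unfolding T_def by (rule summable_comparison_test[OF _ zLamD(6)]) auto
  have sB': "summable (\<lambda>k. T k * q + c * (T k / \<mu> + \<mu> * (\<beta> k)\<^sup>2))"
    by (intro summable_add summable_mult summable_mult2 summable_divide sT LamD(6))
  have le: "RR_tail k \<le> T k * q + c * (T k / \<mu> + \<mu> * (\<beta> k)\<^sup>2)" for k
  proof (cases "K < k")
    case True
    have "(\<alpha> k)\<^sup>2 * (1 / (rho t)\<^sup>2 - 1) \<le> (\<alpha> k)\<^sup>2 * q" using r(3) by (intro mult_left_mono) auto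
    moreover have "2 * t * c0 * \<alpha> k * \<beta> k / rho t = c * (2 * \<alpha> k * \<beta> k)" unfolding c_def by simp
    moreover have "c * (2 * \<alpha> k * \<beta> k) \<le> c * ((\<alpha> k)\<^sup>2 / \<mu> + \<mu> * (\<beta> k)\<^sup>2)"
      using two_mult_le_weighted_squares[OF \<mu>(1)] c(1) by (intro mult_left_mono) auto
    ultimately show ?thesis unfolding RR_tail_def T_def using True by simp
  next
    case False
    then show ?thesis unfolding RR_tail_def T_def using c(1) \<mu> by simp
  qed
  have bound: "norm (RR_tail k) \<le> (\<alpha> k)\<^sup>2 * \<bar>1 / (rho t)\<^sup>2 - 1\<bar> + \<bar>2 * t * c0 / rho t\<bar> * \<bar>\<alpha> k * \<beta> k\<bar>"
    for k
    unfolding RR_tail_def by (auto simp: abs_mult intro!: order_trans[OF abs_triangle_ineq])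
  have "summable (\<lambda>k. (\<alpha> k)\<^sup>2 * \<bar>1 / (rho t)\<^sup>2 - 1\<bar> + \<bar>2 * t * c0 / rho t\<bar> * \<bar>\<alpha> k * \<beta> k\<bar>)"
    by (intro summable_add summable_mult summable_mult2 zLamD(6) summable_prod_abs(1)[OF zLamD(6) LamD(6)])
  then show sR: "summable RR_tail" by (rule summable_comparison_test[rotated]) (use bound in blast)
  have "(\<Sum>k. RR_tail k) \<le> (\<Sum>k. T k * q + c * (T k / \<mu> + \<mu> * (\<beta> k)\<^sup>2))"
    by (rule suminf_le[OF le sR sB'])
  also have "\<dots> = (\<Sum>k. T k) * q + c * ((\<Sum>k. T k) / \<mu> + \<mu> * (\<Sum>k. (\<beta> k)\<^sup>2))"
  proof -
    have s1: "summable (\<lambda>k. T k * q)" and s2: "summable (\<lambda>k. T k / \<mu>)"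
      and s3: "summable (\<lambda>k. \<mu> * (\<beta> k)\<^sup>2)"
      by (intro summable_mult2 summable_divide summable_mult sT LamD(6))+
    have s23: "summable (\<lambda>k. T k / \<mu> + \<mu> * (\<beta> k)\<^sup>2)" by (rule summable_add[OF s2 s3])
    show ?thesis
      using suminf_add[OF s1 summable_mult[OF s23], symmetric] suminf_mult2[OF sT, symmetric]
        suminf_mult[OF s23] suminf_add[OF s2 s3, symmetric] suminf_divide[OF sT] suminf_mult[OF LamD(6)]
      by simp
  qed
  also have "\<dots> \<le> \<mu>\<^sup>2 * q + c * (\<mu>\<^sup>2 / \<mu> + \<mu> * 1)"
    using tail LamD(7) \<mu> c(1) t BD_nonneg a_less_1 unfolding T_def[symmetric] q_def
    by (intro add_mono mult_mono mult_left_mono divide_right_mono) auto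
  also have "\<dots> \<le> q * \<mu>\<^sup>2 + (2 * t * c0) * (2 * \<mu>)"
    using c \<mu> by (simp add: power2_eq_square mult_right_mono)
  finally show "(\<Sum>k. RR_tail k) \<le> 8 * t * (1 + BD) / (1 - a) * \<mu>\<^sup>2 + 4 * t * c0 * \<mu>"
    unfolding q_def by (simp add: algebra_simps)
qed

lemma RR_summable: "summable RR"
  unfolding RR_def[abs_def] by (intro summable_add summable_RR_heavy RR_tail_summable_le(1) summable_mult LamD(6))

lemma gam_sq_heavy:
  assumes k: "k \<in> heavy_upto K"
  shows "(\<gamma> k)\<^sup>2 \<le> (\<alpha> k)\<^sup>2 + (2 * \<sigma> * t * \<alpha> k * eta K g \<beta> u k + t\<^sup>2 * Beta\<^sup>2)"
proof -
  have "\<bar>\<sigma> * t * eta K g \<beta> u k\<bar> \<le> \<bar>t * Beta\<bar>"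
    using eta_bound[OF L K0 k] \<sigma> t by (simp add: abs_mult mult_left_mono)
  then have "(\<sigma> * t * eta K g \<beta> u k)\<^sup>2 \<le> (t * Beta)\<^sup>2" by (simp only: abs_le_square_iff)
  moreover have "(\<gamma> k)\<^sup>2 = (\<alpha> k)\<^sup>2 + 2 * \<sigma> * t * \<alpha> k * eta K g \<beta> u k + (\<sigma> * t * eta K g \<beta> u k)\<^sup>2"
    unfolding gam_def using k by (simp add: power2_sum algebra_simps)
  ultimately show ?thesis by (simp add: power_mult_distrib)
qed

lemma gam_sq_le: "(\<gamma> k)\<^sup>2 \<le> (\<alpha> k)\<^sup>2 + RR k"
proof -
  have r: "rho t > 0" using rho_props(1)[OF T1 t] by simp
  consider (heavy) "k \<in> heavy_upto K" | (light) "k \<in> light_upto K" | (tail) "K < k"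
    | (zero) "k \<notin> heavy_upto K" "k \<notin> light_upto K" "k \<le> K"
    unfolding heavy_upto_def light_upto_def by force
  then show ?thesis
  proof cases
    case heavy
    then have "\<not> K < k" unfolding heavy_upto_def by auto
    then have "RR k = (2 * \<sigma> * t * \<alpha> k * eta K g \<beta> u k + t\<^sup>2 * Beta\<^sup>2) + t\<^sup>2 * c0\<^sup>2 * (\<beta> k)\<^sup>2"
      using heavy unfolding RR_def RR_heavy_def RR_tail_def by simp
    moreover have "0 \<le> t\<^sup>2 * c0\<^sup>2 * (\<beta> k)\<^sup>2" by simp
    ultimately show ?thesis using gam_sq_heavy[OF heavy] by linarith
  next
    case light
    then have "\<not> K < k" "k \<notin> heavy_upto K" unfolding light_upto_def heavy_upto_def by auto
    then show ?thesis using light unfolding RR_def RR_heavy_def RR_tail_def gam_def by simp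
  next
    case tail
    then have nh: "k \<notin> heavy_upto K" and "k \<notin> light_upto K" unfolding light_upto_def heavy_upto_def by auto
    then have "(\<gamma> k)\<^sup>2 = (\<alpha> k / rho t + t * c0 * \<beta> k)\<^sup>2" unfolding gam_def by simp
    then show ?thesis using tail nh r unfolding RR_def RR_heavy_def RR_tail_def
      by (simp add: power2_eq_square field_simps)
  next
    case zero
    then show ?thesis using alpha_zero_off_heavy_light[OF zero] unfolding RR_def RR_heavy_def RR_tail_def gam_def
      by (simp add: power_mult_distrib)
  qed
qed

lemma summable_gam_sq: "summable (\<lambda>k. (\<gamma> k)\<^sup>2)"
proof (rule summable_comparison_test)
  show "summable (\<lambda>k. (\<alpha> k)\<^sup>2 + RR k)" by (intro summable_add zLamD(6) RR_summable)
  show "\<exists>N. \<forall>n\<ge>N. norm ((\<gamma> n)\<^sup>2) \<le> (\<alpha> n)\<^sup>2 + RR n" using gam_sq_le by auto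
qed

lemma suminf_gam_sq_le: "(\<Sum>k. (\<gamma> k)\<^sup>2) \<le> 1 + t * WW K t \<mu>"
proof -
  have sC: "summable (\<lambda>k. t\<^sup>2 * c0\<^sup>2 * (\<beta> k)\<^sup>2)" by (intro summable_mult LamD(6))
  have "(\<Sum>k. (\<gamma> k)\<^sup>2) \<le> (\<Sum>k. (\<alpha> k)\<^sup>2 + RR k)"
    by (intro suminf_le gam_sq_le summable_gam_sq summable_add zLamD(6) RR_summable)
  also have "\<dots> = (\<Sum>k. (\<alpha> k)\<^sup>2) + (\<Sum>k. RR_heavy k) + (\<Sum>k. RR_tail k) + t\<^sup>2 * c0\<^sup>2 * (\<Sum>k. (\<beta> k)\<^sup>2)"
    unfolding RR_def
    using suminf_add[OF zLamD(6) summable_add[OF summable_add[OF summable_RR_heavy RR_tail_summable_le(1)] sC]]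
      suminf_add[OF summable_add[OF summable_RR_heavy RR_tail_summable_le(1)] sC]
      suminf_add[OF summable_RR_heavy RR_tail_summable_le(1)] suminf_mult[OF LamD(6)]
    by simp
  also have "\<dots> \<le> 1 + t\<^sup>2 * Beta\<^sup>2 * (real K + 1) + (8 * t * (1 + BD) / (1 - a) * \<mu>\<^sup>2 + 4 * t * c0 * \<mu>)
      + t\<^sup>2 * c0\<^sup>2 * 1"
    using zLamD(7) sum_RR_heavy_le RR_tail_summable_le(2) LamD(7)
    by (intro add_mono mult_left_mono) auto
  also have "\<dots> = 1 + t * WW K t \<mu>" unfolding WW_def by (simp add: algebra_simps power2_eq_square)
  finally show ?thesis .
qed

lemma gam_zero: "\<gamma> k = 0 \<Longrightarrow> \<alpha> k = 0 \<and> \<beta> k = 0"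
proof -
  assume g0: "\<gamma> k = 0"
  have r: "rho t > 0" using rho_props(1)[OF T1 t] by simp
  have nH: "k \<notin> heavy_upto K"
  proof
    assume k: "k \<in> heavy_upto K"
    have "\<gamma> k \<ge> \<alpha> k / 2" by (rule gam_heavy_ge[OF k])
    moreover have "\<alpha> k > 0" using k heavy_pos unfolding heavy_upto_def by auto
    ultimately show False using g0 by simp
  qed
  have nS: "k \<notin> light_upto K"
  proof
    assume k: "k \<in> light_upto K"
    then have "\<gamma> k = \<alpha> k" "\<alpha> k > 0" unfolding gam_def light_upto_def using nH by auto
    then show False using g0 by simp
  qed
  have "\<alpha> k / rho t + t * c0 * \<beta> k = 0" using g0 nH nS unfolding gam_def by simp
  moreover have "\<alpha> k / rho t \<ge> 0" using zLamD(4)[of k] r by simp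
  moreover have "t * c0 * \<beta> k \<ge> 0" using t c0_ge LamD(4)[of k] by simp
  ultimately have "\<alpha> k / rho t = 0" "t * c0 * \<beta> k = 0" by linarith+
  then show ?thesis using r t c0_ge by auto
qed

lemma gam_mult_vv: "\<gamma> k * vv K g \<beta> u t \<sigma> k y = \<alpha> k * ys k y + \<sigma> * t * \<beta> k * u k y"
proof (cases "\<gamma> k = 0")
  case True then show ?thesis using gam_zero by simp
next
  case False then show ?thesis unfolding vv_def by simp
qed

lemma dual_norm_rescaled_coordinate:
  assumes s: "1 \<le> s" "s - 1 \<le> t * WW K t \<mu> / 2"
  shows "DN k (P k (\<lambda>x. xs x + \<sigma> * t * g x) (\<lambda>y. s * vv K g \<beta> u t \<sigma> k y))
    \<le> 1 + \<sigma> * t * Dv K g \<beta> u + t * (t * EE K + \<epsilon>' * BH K + 4 * WW K t \<mu>)"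
proof -
  let ?G = "\<lambda>x. xs x + \<sigma> * t * g x"
  have Gbl: "bounded_linear ?G" by (rule bounded_linear_add[OF bounded_linear_xs bounded_linear_const_mult[OF LamD(1)]])
  note vy = y_functional_vv
  have b1: "Z.bounded_functional k (P k ?G (vv K g \<beta> u t \<sigma> k))" by (rule pair_fun_bounded[OF Gbl vy])
  have b2: "Z.bounded_functional k (P k (\<lambda>_. 0) (vv K g \<beta> u t \<sigma> k))" by (rule pair_fun_y_bounded[OF vy])
  have "P k ?G (\<lambda>y. s * vv K g \<beta> u t \<sigma> k y)
      = (\<lambda>v. 1 * P k ?G (vv K g \<beta> u t \<sigma> k) v + (s - 1) * P k (\<lambda>_. 0) (vv K g \<beta> u t \<sigma> k) v)"
    by (auto simp: pair_fun_def algebra_simps)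
  then have "DN k (P k ?G (\<lambda>y. s * vv K g \<beta> u t \<sigma> k y))
      \<le> \<bar>1\<bar> * DN k (P k ?G (vv K g \<beta> u t \<sigma> k)) + \<bar>s - 1\<bar> * DN k (P k (\<lambda>_. 0) (vv K g \<beta> u t \<sigma> k))"
    using Z.dual_norm_lincomb[OF b1 b2, of 1 "s - 1"] by simp
  also have "\<dots> \<le> (1 + \<sigma> * t * Dv K g \<beta> u + t\<^sup>2 * EE K + \<epsilon>' * (t * BH K)) + (t * WW K t \<mu> / 2) * 8"
  proof -
    have "\<bar>s - 1\<bar> * DN k (P k (\<lambda>_. 0) (vv K g \<beta> u t \<sigma> k)) \<le> (t * WW K t \<mu> / 2) * (2 * 4)"
      using s dual_norm_pair_fun_y[OF vy] Z.dual_norm_nonneg[OF b2] by (intro mult_mono) auto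
    then show ?thesis using dual_norm_coordinate[of k] by simp
  qed
  also have "\<dots> = 1 + \<sigma> * t * Dv K g \<beta> u + t * (t * EE K + \<epsilon>' * BH K + 4 * WW K t \<mu>)"
    by (simp add: algebra_simps power2_eq_square)
  finally show ?thesis .
qed

lemma suminf_gam_vv:
  assumes "(x, y) \<in> SS"
  shows "(\<Sum>k. \<gamma> k * vv K g \<beta> u t \<sigma> k (y k))
    = (\<Sum>k. \<alpha> k * ys k (y k)) + \<sigma> * t * (\<Sum>k. \<beta> k * u k (y k))"
proof -
  have sa: "summable (\<lambda>k. \<alpha> k * ys k (y k))" by (rule weighted_series(1)[OF assms zLamD(6) zLamD(3)])
  have sb: "summable (\<lambda>k. \<beta> k * u k (y k))" by (rule weighted_series(1)[OF assms LamD(6) LamD(3)])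
  have "(\<Sum>k. \<gamma> k * vv K g \<beta> u t \<sigma> k (y k)) = (\<Sum>k. \<alpha> k * ys k (y k) + (\<sigma> * t) * (\<beta> k * u k (y k)))"
    using gam_mult_vv by (simp add: mult.assoc)
  also have "\<dots> = (\<Sum>k. \<alpha> k * ys k (y k)) + (\<sigma> * t) * (\<Sum>k. \<beta> k * u k (y k))"
    using suminf_add[OF sa summable_mult[OF sb, of "\<sigma> * t"]] suminf_mult[OF sb, of "\<sigma> * t"] by simp
  finally show ?thesis by simp
qed

text \<open>Dividing by the bound m on the norms of its coordinates and by the l2-norm s of the new
  weights \<gamma>, the functional x* + \<sigma> t g + \<Sum> \<gamma>_k (\<dots>) becomes an element of Lambda; hence its value
  at any w in the unit ball of Sigma is at most m.\<close>
lemma perturbation_le: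
  assumes w: "w \<in> SS" "snorm w \<le> 1" and X: "t * EE K + \<epsilon>' * BH K + 4 * WW K t \<mu> \<le> \<epsilon>"
  shows "lam xs \<alpha> ys w + \<sigma> * t * lam g \<beta> u w \<le> 1 + \<sigma> * t * Dv K g \<beta> u + t * \<epsilon>"
proof -
  obtain x y where xy: "w = (x, y)" by fastforce
  define s where "s = max 1 (sqrt (\<Sum>k. (\<gamma> k)\<^sup>2))"
  define m where "m = 1 + \<sigma> * t * Dv K g \<beta> u + t * (t * EE K + \<epsilon>' * BH K + 4 * WW K t \<mu>)"
  have W0: "WW K t \<mu> \<ge> 0" using WW_nonneg t \<mu> by simp
  have s: "1 \<le> s" "(\<Sum>k. (\<gamma> k)\<^sup>2) \<le> s\<^sup>2" "s - 1 \<le> t * WW K t \<mu> / 2"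
    using max_one_sqrt_bounds[OF suminf_nonneg[OF summable_gam_sq] suminf_gam_sq_le] W0 t unfolding s_def by auto
  have "\<bar>\<sigma> * t * Dv K g \<beta> u\<bar> \<le> t * BD" using Dv_bound[OF L K0] \<sigma> t by (simp add: abs_mult mult_left_mono)
  moreover have "t * BD \<le> 1/2" using T1 a_nonneg t by (simp add: algebra_simps)
  moreover have "0 \<le> t * (t * EE K + \<epsilon>' * BH K + 4 * WW K t \<mu>)"
    unfolding EE_def BH_def using t \<epsilon>' W0 BD_nonneg Beta_ge am_pos[of K]
    by (intro mult_nonneg_nonneg add_nonneg_nonneg divide_nonneg_nonneg) auto
  ultimately have m: "m > 0" unfolding m_def by (simp add: abs_le_iff)
  let ?G = "\<lambda>x. xs x + \<sigma> * t * g x"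
  have LL: "Lam (\<lambda>x. (1/m) * ?G x) (\<lambda>k. \<gamma> k / s) (\<lambda>k y. (1/m) * (s * vv K g \<beta> u t \<sigma> k y))"
    using in_Lambda_normalized[OF bounded_linear_add[OF bounded_linear_xs bounded_linear_const_mult[OF LamD(1)]] m s(1)
        gam_nonneg summable_gam_sq s(2) y_functional_vv]
      dual_norm_rescaled_coordinate[OF s(1,3)] unfolding m_def by blast
  have "lam (\<lambda>x. (1/m) * ?G x) (\<lambda>k. \<gamma> k / s) (\<lambda>k y. (1/m) * (s * vv K g \<beta> u t \<sigma> k y)) (x, y) \<le> 1"
    using lam_fun_le_sigma_norm[OF LL, of "(x, y)"] w xy by simp
  then have "(1/m) * (?G x + (\<Sum>k. \<gamma> k * vv K g \<beta> u t \<sigma> k (y k))) \<le> 1"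
    using lam_fun_normalized(2)[OF LL m s(1) summable_gam_sq y_functional_vv] w xy
    by simp
  then have "?G x + (\<Sum>k. \<gamma> k * vv K g \<beta> u t \<sigma> k (y k)) \<le> m" using m by (simp add: divide_le_eq mult.commute)
  moreover have "t * (t * EE K + \<epsilon>' * BH K + 4 * WW K t \<mu>) \<le> t * \<epsilon>" using X t by simp
  ultimately show ?thesis
    using suminf_gam_vv[of x y] w xy unfolding m_def by (simp add: lam_fun_eq algebra_simps)
qed

end

abbreviation "ff \<equiv> lam xs \<alpha> ys"

lemma uniform_smoothness_along_Lambda:
  assumes \<epsilon>: "\<epsilon> > 0"
  shows "\<exists>t>0. \<forall>g \<beta> u. Lam g \<beta> u \<longrightarrow> (\<exists>D. \<forall>w\<in>SS. snorm w \<le> 1 \<longrightarrow>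
           ff w + t * lam g \<beta> u w \<le> 1 + t * D + t * \<epsilon> \<and> ff w - t * lam g \<beta> u w \<le> 1 - t * D + t * \<epsilon>)"
proof -
  obtain \<mu> where \<mu>: "0 < \<mu>" "\<mu> \<le> 1" and \<mu>C: "(32 * (1 + BD) / (1 - a)) * \<mu>\<^sup>2 + (16 * c0) * \<mu> \<le> \<epsilon> / 3"
    using exists_small_quadratic[of "32 * (1 + BD) / (1 - a)" "16 * c0" "\<epsilon> / 3"] BD_nonneg a_less_1 c0_ge \<epsilon>
    by auto
  obtain M where M: "\<And>K. K \<ge> M \<Longrightarrow> (\<Sum>k. if K < k then (\<alpha> k)\<^sup>2 else 0) \<le> \<mu>\<^sup>2"
    using eventually_tail_sum_le[OF zLamD(6), of "\<mu>\<^sup>2"] \<mu> by auto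
  define K where "K = max M k0"
  have K0: "(\<exists>k. heavy k) \<longrightarrow> k0 \<le> K" and tail: "(\<Sum>k. if K < k then (\<alpha> k)\<^sup>2 else 0) \<le> \<mu>\<^sup>2"
    using M[of K] unfolding K_def by auto
  have BHp: "BH K > 0" unfolding BH_def using Beta_ge am_pos[of K] by (simp add: add_pos_nonneg)
  define \<epsilon>' where "\<epsilon>' = \<epsilon> / (3 * BH K)"
  have \<epsilon>': "\<epsilon>' > 0" "\<epsilon>' * BH K = \<epsilon> / 3" unfolding \<epsilon>'_def using \<epsilon> BHp by auto
  have "\<exists>\<delta>>0. \<forall>k\<in>heavy_upto K. \<forall>h\<in>ZD k. DN k h < \<delta> \<longrightarrow> DN k (\<lambda>v. \<phi> k v + h v) \<le> nn k + deriv k h + \<epsilon>' * DN k h"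
  proof (rule finite_uniform_delta[OF finite_heavy_upto])
    fix k assume "k \<in> heavy_upto K"
    then show "\<exists>\<delta>>0. \<forall>h\<in>ZD k. DN k h < \<delta> \<longrightarrow> DN k (\<lambda>v. \<phi> k v + h v) \<le> nn k + deriv k h + \<epsilon>' * DN k h"
      using Z.supporting_derivativeD(5)[OF deriv_supporting \<epsilon>'(1)] unfolding heavy_upto_def by blast
  qed auto
  then obtain \<delta> where \<delta>: "\<delta> > 0"
    and fr: "\<forall>k\<in>heavy_upto K. \<forall>h\<in>ZD k. DN k h < \<delta> \<longrightarrow> DN k (\<lambda>v. \<phi> k v + h v) \<le> nn k + deriv k h + \<epsilon>' * DN k h"
    by blast
  define C2 where "C2 = EE K + 4 * (real K + 1) * Beta\<^sup>2 + 4 * c0\<^sup>2"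
  obtain t where t: "0 < t" and small: "\<forall>(c, b)\<in>set [(1 + BD, (1 - a) / 2), (Beta, am K / 2),
      (1 + 2 / am K + BD, (1 - a) / 2), (BH K, \<delta>), (C2, \<epsilon> / 3)]. t * c < b"
    using exists_pos_mult_less[of "[(1 + BD, (1 - a) / 2), (Beta, am K / 2),
      (1 + 2 / am K + BD, (1 - a) / 2), (BH K, \<delta>), (C2, \<epsilon> / 3)]"] a_less_1 am_pos[of K] \<delta> \<epsilon> by auto
  then have T1: "t * (1 + BD) \<le> (1 - a) / 2" and T2: "t * Beta \<le> am K / 2"
    and T3: "t * (1 + 2 / am K) \<le> (1 - a) / 2 - t * BD" and T4: "t * BH K < \<delta>"
    and T5: "t * C2 \<le> \<epsilon> / 3"
    by (auto simp: algebra_simps)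
  have "4 * WW K t \<mu> = t * (4 * (real K + 1) * Beta\<^sup>2 + 4 * c0\<^sup>2)
      + ((32 * (1 + BD) / (1 - a)) * \<mu>\<^sup>2 + (16 * c0) * \<mu>)"
    unfolding WW_def by (simp add: algebra_simps)
  moreover have "t * EE K + t * (4 * (real K + 1) * Beta\<^sup>2 + 4 * c0\<^sup>2) = t * C2"
    unfolding C2_def by (simp add: algebra_simps)
  ultimately have X: "t * EE K + \<epsilon>' * BH K + 4 * WW K t \<mu> \<le> \<epsilon>" using T5 \<mu>C \<epsilon>'(2) by linarith
  have "\<exists>D. \<forall>w\<in>SS. snorm w \<le> 1 \<longrightarrow>
      ff w + t * lam g \<beta> u w \<le> 1 + t * D + t * \<epsilon> \<and> ff w - t * lam g \<beta> u w \<le> 1 - t * D + t * \<epsilon>"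
    if L: "Lam g \<beta> u" for g \<beta> u
    using perturbation_le[OF L K0 _ t T1 T2 T3 T4 fr less_imp_le[OF \<epsilon>'(1)] \<mu> tail _ _ X, of 1]
      perturbation_le[OF L K0 _ t T1 T2 T3 T4 fr less_imp_le[OF \<epsilon>'(1)] \<mu> tail _ _ X, of "-1"]
    by (intro exI[of _ "Dv K g \<beta> u"]) auto
  then show ?thesis using t by blast
qed

text \<open>Adding the two one-sided bounds, at w for +g and at w' for -g, cancels the unknown first
  order term D.\<close>
lemma strongly_exposing: "Sig.strongly_exposing ff"
  unfolding Sig.strongly_exposing_def
proof (intro allI impI)
  fix \<epsilon> :: real assume \<epsilon>: "\<epsilon> > 0"
  obtain t where t: "t > 0" and P: "\<forall>g \<beta> u. Lam g \<beta> u \<longrightarrow> (\<exists>D. \<forall>w\<in>SS. snorm w \<le> 1 \<longrightarrow>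
           ff w + t * lam g \<beta> u w \<le> 1 + t * D + t * (\<epsilon>/4) \<and> ff w - t * lam g \<beta> u w \<le> 1 - t * D + t * (\<epsilon>/4))"
    using uniform_smoothness_along_Lambda[of "\<epsilon>/4"] \<epsilon> by auto
  show "\<exists>\<delta>>0. \<forall>w\<in>SS. \<forall>w'\<in>SS. snorm w \<le> 1 \<longrightarrow> snorm w' \<le> 1 \<longrightarrow>
      1 - \<delta> \<le> ff w \<longrightarrow> 1 - \<delta> \<le> ff w' \<longrightarrow> snorm (sadd w (sscale (-1) w')) \<le> \<epsilon>"
  proof (intro exI[of _ "t * \<epsilon> / 4"] conjI ballI impI)
    show "t * \<epsilon> / 4 > 0" using t \<epsilon> by simp
    fix w w' assume w: "w \<in> SS" "snorm w \<le> 1" and w': "w' \<in> SS" "snorm w' \<le> 1"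
      and fw: "ff w \<ge> 1 - t * \<epsilon> / 4" and fw': "ff w' \<ge> 1 - t * \<epsilon> / 4"
    have lam_diff_le: "lam g \<beta> u v - lam g \<beta> u v' \<le> \<epsilon>"
      if L: "Lam g \<beta> u" and v: "v \<in> SS" "snorm v \<le> 1" "ff v \<ge> 1 - t * \<epsilon> / 4"
        and v': "v' \<in> SS" "snorm v' \<le> 1" "ff v' \<ge> 1 - t * \<epsilon> / 4" for g \<beta> u v v'
    proof -
      obtain D where D: "\<forall>w\<in>SS. snorm w \<le> 1 \<longrightarrow>
           ff w + t * lam g \<beta> u w \<le> 1 + t * D + t * (\<epsilon>/4) \<and> ff w - t * lam g \<beta> u w \<le> 1 - t * D + t * (\<epsilon>/4)"
        using P L by blast
      have bound_v: "ff v + t * lam g \<beta> u v \<le> 1 + t * D + t * (\<epsilon>/4)" using D v by auto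
      have bound_v': "ff v' - t * lam g \<beta> u v' \<le> 1 - t * D + t * (\<epsilon>/4)" using D v' by auto
      have "t * (lam g \<beta> u v - lam g \<beta> u v') \<le> t * \<epsilon>" using bound_v bound_v' v(3) v'(3) by (simp add: algebra_simps)
      then show ?thesis using t by simp
    qed
    show "snorm (sadd w (sscale (-1) w')) \<le> \<epsilon>"
    proof (rule sigma_norm_least)
      fix g \<beta> u assume L: "Lam g \<beta> u"
      have "lam g \<beta> u (sadd w (sscale (-1) w')) = lam g \<beta> u w - lam g \<beta> u w'"
        using lam_fun_sadd[OF L w(1) SigmaSet_sscale[OF w'(1)]] lam_fun_sscale[OF L w'(1), of "-1"] by simp
      moreover have "lam g \<beta> u w - lam g \<beta> u w' \<le> \<epsilon>" by (rule lam_diff_le[OF L w fw w' fw'])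
      moreover have "lam g \<beta> u w' - lam g \<beta> u w \<le> \<epsilon>" by (rule lam_diff_le[OF L w' fw' w fw])
      ultimately show "\<bar>lam g \<beta> u (sadd w (sscale (-1) w'))\<bar> \<le> \<epsilon>" by simp
    qed
  qed
qed

lemma frechet_diff_dual_norm_at_z: "frechet_diff_dual_norm sadd sscale SS snorm ff"
proof (rule Sig.frechet_diff_dual_norm_if_strongly_exposing[OF _ zS strongly_exposing])
  show "Sig.bounded_functional ff"
    unfolding Sig.bounded_functional_def using lam_fun_sscale[OF zLam] lam_fun_le_sigma_norm[OF zLam]
    by (intro conjI allI ballI exI[of _ 1]) auto
qed

end
theorem lemma3p4:
  fixes Yset :: "nat \<Rightarrow> 'y::real_vector set"
    and N :: "nat \<Rightarrow> 'x::banach \<times> 'y \<Rightarrow> real"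
    and xs :: "'x \<Rightarrow> real" and \<alpha> :: "nat \<Rightarrow> real" and ys :: "nat \<Rightarrow> 'y \<Rightarrow> real"
  assumes Ysub: "\<And>k. subspace (Yset k)"
    and Nnorm: "\<And>k. is_norm_on (UNIV \<times> Yset k) (N k)"
    and Ycomplete: "\<And>k. complete_norm_on (Yset k) (Ynorm N k)"
    and NX: "\<And>k x. N k (x, 0) = norm x"
    and Nmono: "\<And>k x y. y \<in> Yset k \<Longrightarrow> N k (x, y) \<ge> norm x"
    and smooth: "\<And>k. dual_frechet_smooth (+) (*\<^sub>R) (UNIV \<times> Yset k) (N k)"
    and zLam: "in_Lambda Yset N xs \<alpha> ys"
    and zS: "dual_norm (SigmaSet Yset N) (sigma_norm Yset N) (lam_fun Yset N xs \<alpha> ys) = 1"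
    and xsmall: "onorm xs < 1"
  shows "frechet_diff_dual_norm sadd sscale (SigmaSet Yset N) (sigma_norm Yset N)
           (lam_fun Yset N xs \<alpha> ys)"
proof -
  interpret smooth_point Yset N xs \<alpha> ys
    by unfold_locales (fact Ysub Nnorm NX Nmono smooth zLam zS xsmall)+
  show ?thesis by (rule frechet_diff_dual_norm_at_z)
qed

end
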